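(* Let $\mathbf{A}(x,\lambda)$ be a $3\times3$ matrix-valued function of $x\in\mathbb{R}$ and $\lambda\in\mathbb{C}$, $T$-periodic in $x$ for some $T>0$, satisfying (A1) and (A2) (stated in the context), with $\operatorname{tr}(\mathbf{A}(x,\lambda))=0$ for all $x\in\mathbb{R}$ and $\lambda\in\mathbb{C}$. Let $f(\lambda)=\operatorname{tr}(\mathbf{M}(\lambda))$, where $\mathbf{M}(\lambda)$ is the monodromy matrix of $\mathbf{v}_x=\mathbf{A}(x,\lambda)\mathbf{v}$. If the $L^2(\mathbb{R})$ essential spectrum of $\lambda v=\mathcal{J}\mathcal{L}v$ bifurcates at $\lambda\in i\mathbb{R}$ away from the imaginary axis in a transversal manner, alongside the spectrum on the axis, then $$\Phi_3(\lambda):=f'(\lambda)^3+f'(-\lambda)^3+f(\lambda)f'(-\lambda)^2f'(\lambda)+f(-\lambda)f'(\lambda)^2f'(-\lambda)=0.$$ Conversely, if $\lambda\in i\mathbb{R}$, $\Phi_3(\lambda)=0$, and $$\Delta_3(\lambda)\neq0\quad\text{and}\quad f'(-\lambda)f''(\lambda)\neq-f'(\lambda)f''(-\lambda),$$ where $\Delta_3(\lambda)=|f(\lambda)|^4-4f(\lambda)^3-4\overline{f(\lambda)}^3+18|f(\lambda)|^2-27$, then the spectrum bifurcates at $\lambda$ away from the imaginary axis. Moreover, the spectrum exhibits the normal form $$\Delta\lambda=\alpha\sqrt{\Delta\mu}+o(\sqrt{\Delta\mu})\qquad\text{for }|\Delta\lambda|,|\Delta\mu|\ll1$$ for a constant 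$\alpha$.
   Context: Assumptions. (A1) $\mathbf{A}(x,\lambda)$ is real for $\lambda\in\mathbb{R}$. (A2) $\mathbf{A}^\top(x,\lambda)\mathbf{B}(\lambda)=-\mathbf{B}(\lambda)\mathbf{A}(x,-\lambda)$ for some matrix $\mathbf{B}(\lambda)$, independent of $x$, and nonsingular for all $\lambda\in\mathbb{C}$ except at most finitely many values of $\lambda$ ($\top$ is the non-conjugated transpose). Regularity: $\mathbf{A}$ is continuous in $(x,\lambda)$ and, for each $x$, entire in $\lambda$. Monodromy matrix: $\mathbf{M}(\lambda)=\mathbf{V}(T,\lambda)$, where $\mathbf{V}_x=\mathbf{A}(x,\lambda)\mathbf{V}$, $\mathbf{V}(0,\lambda)=\mathbf{I}_3$ (identity matrix). Its characteristic polynomial is $p(\mu,\lambda)=\det(\mathbf{M}(\lambda)-\mu\mathbf{I}_3)$. The function $f$ is regarded as a function on $\mathbb{C}$; the prime denotes ordinary differentiation in $\lambda$, and $f'(-\lambda)$, $f''(-\lambda)$ are the derivatives $f',f''$ evaluated at $-\lambda$. Spectrum: $\mathbf{v}_x=\mathbf{A}(x,\lambda)\mathbf{v}$ is the first-order reformulation of a spectral problem $\lambda v=\mathcal{J}\mathcal{L}v$, where $\mathcal{J}$ represents a symplectic form, $\mathcal{L}$ is a linear self-adjoint operator, and $\mathcal{J}\mathcal{L}$ has $T$-periodic coefficients in $x$. By Floquet theory the $L^2(\mathbb{R})$ essential spectrum is $\{\lambda\in\mathbb{C}: p(\mu,\lambda)=0\text{ for some }|\mu|=1\}$. Bifurcation: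 the spectrum bifurcates at $\lambda_0\in i\mathbb{R}$ away from the imaginary axis (in a transversal manner, alongside the spectrum on the axis) if, in addition to a nondegenerate segment of $i\mathbb{R}$ containing $\lambda_0$ that lies in the spectrum, there is a curve of spectrum emanating from $\lambda_0$ into $\mathbb{C}\setminus i\mathbb{R}$ that is not tangent to $i\mathbb{R}$ at $\lambda_0$. Normal form: at the bifurcation point $\lambda_0$, let $\mu_0$ with $|\mu_0|=1$ satisfy $p(\mu_0,\lambda_0)=p_\lambda(\mu_0,\lambda_0)=0$ (subscript denoting partial derivative). Then $\Delta\lambda=\lambda-\lambda_0$ and $\Delta\mu=\mu-\mu_0$, where $p(\mu,\lambda)=0$ with $|\mu|=1$ near $(\mu_0,\lambda_0)$, and both branches of the square root are taken. *)

theory Defs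
  imports "HOL-Complex_Analysis.Complex_Analysis" "HOL-Library.Landau_Symbols"
begin

definition imaginary_axis :: "complex set" where
  "imaginary_axis = {z. Re z = 0}"

definition fundamental_matrix ::
  "(real \<Rightarrow> complex \<Rightarrow> complex^3^3) \<Rightarrow> (real \<Rightarrow> complex \<Rightarrow> complex^3^3) \<Rightarrow> bool" where
  "fundamental_matrix A V \<longleftrightarrow>
     (\<forall>s. V 0 s = mat 1 \<and>
        (\<forall>x. ((\<lambda>y. V y s) has_vector_derivative (A x s ** V x s)) (at x)))"

(* s is the spectral parameter; mat \<mu> is the scalar matrix \<mu> I *)
definition floquet_poly :: "(complex \<Rightarrow> complex^3^3) \<Rightarrow> complex \<Rightarrow> complex \<Rightarrow> complex" where
  "floquet_poly M \<mu> s = det (M s - mat \<mu>)"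

(* The L^2(R) essential spectrum of the periodic-coefficient problem, in the form given
   by Floquet theory: some Floquet multiplier lies on the unit circle. *)
definition essential_spectrum :: "(complex \<Rightarrow> complex^3^3) \<Rightarrow> complex set" where
  "essential_spectrum M = {s. \<exists>\<mu>. norm \<mu> = 1 \<and> floquet_poly M \<mu> s = 0}"

(* The unit vector \<tau> is the direction in which the curve g leaves its starting point; it is
   the limit of secant directions, so it does not depend on the parametrization. The curve
   is not tangent to the imaginary axis exactly when \<tau> is not purely imaginary. *)
definition bifurcates_off_axis :: "complex set \<Rightarrow> complex \<Rightarrow> bool" where
  "bifurcates_off_axis S s0 \<longleftrightarrow>
     (\<exists>a b. a \<in> imaginary_axis \<and> b \<in> imaginary_axis \<and> a \<noteq> b \<and>
        s0 \<in> closed_segment a b \<and> closed_segment a b \<subseteq> S) \<and>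
     (\<exists>g \<tau>. path g \<and> pathstart g = s0 \<and> path_image g \<subseteq> S \<and>
        (\<forall>t\<in>{0<..1}. g t \<notin> imaginary_axis) \<and>
        ((\<lambda>t. sgn (g t - s0)) \<longlongrightarrow> \<tau>) (at_right 0) \<and> \<tau> \<notin> imaginary_axis)"

definition Phi3 :: "(complex \<Rightarrow> complex) \<Rightarrow> complex \<Rightarrow> complex" where
  "Phi3 f s = deriv f s ^ 3 + deriv f (-s) ^ 3
     + f s * deriv f (-s) ^ 2 * deriv f s + f (-s) * deriv f s ^ 2 * deriv f (-s)"

definition Delta3 :: "(complex \<Rightarrow> complex) \<Rightarrow> complex \<Rightarrow> complex" where
  "Delta3 f s = of_real (norm (f s) ^ 4) - 4 * f s ^ 3 - 4 * cnj (f s) ^ 3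
     + 18 * of_real (norm (f s) ^ 2) - 27"

definition critical_multiplier :: "(complex \<Rightarrow> complex \<Rightarrow> complex) \<Rightarrow> complex \<Rightarrow> complex \<Rightarrow> bool" where
  "critical_multiplier p \<mu>0 s0 \<longleftrightarrow>
     norm \<mu>0 = 1 \<and> p \<mu>0 s0 = 0 \<and> deriv (\<lambda>s. p \<mu>0 s) s0 = 0"

(* For unimodular \<mu> near \<mu>0, the roots s of p \<mu> near s0 are exactly lp \<mu> and lm \<mu>, one for each
   branch of the square root. No continuity of lp and lm in \<mu> is demanded, so the branch
   cut of csqrt is harmless: crossing it merely swaps the two labels. *)
definition sqrt_normal_form ::
  "(complex \<Rightarrow> complex \<Rightarrow> complex) \<Rightarrow> complex \<Rightarrow> complex \<Rightarrow> complex \<Rightarrow> bool" where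
  "sqrt_normal_form p \<mu>0 s0 \<alpha> \<longleftrightarrow>
     (\<exists>r>0. \<exists>d>0. \<exists>lp lm.
        (\<forall>\<mu>. norm \<mu> = 1 \<and> norm (\<mu> - \<mu>0) < d \<longrightarrow>
           {s. norm (s - s0) < r \<and> p \<mu> s = 0} = {lp \<mu>, lm \<mu>}) \<and>
        (\<lambda>\<mu>. (lp \<mu> - s0) - \<alpha> * csqrt (\<mu> - \<mu>0))
          \<in> o[at \<mu>0 within sphere 0 1](\<lambda>\<mu>. csqrt (\<mu> - \<mu>0)) \<and>
        (\<lambda>\<mu>. (lm \<mu> - s0) + \<alpha> * csqrt (\<mu> - \<mu>0))
          \<in> o[at \<mu>0 within sphere 0 1](\<lambda>\<mu>. csqrt (\<mu> - \<mu>0)))"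

end

theory Submission
  imports Defs
begin

text \<open>
  Everything about the spectrum is carried by the scalar function \<open>f\<close>. The trace condition gives
  \<open>det M = 1\<close>, and the relation between \<open>A\<^sup>T\<close> and \<open>B\<close> integrates to
  \<open>M(s)\<^sup>T B M(-s) = B\<close>; hence the second symmetric function of the multipliers at \<open>s\<close> is
  \<open>f(-s)\<close> and the characteristic polynomial is the cubic
  \<open>p(\<mu>, s) = 1 - f(-s) \<mu> + f(s) \<mu>\<^sup>2 - \<mu>\<^sup>3\<close> (\<open>monodromy_floquet_poly\<close>). Euler's method expresses \<open>M\<close> as a
  locally uniform limit of products that are entire in \<open>s\<close> and real for real \<open>s\<close>, so \<open>f\<close> is entire
  and commutes with complex conjugation. The rest is complex analysis of the
  cubic \<open>p\<close>.

  For \<open>|\<mu>| = 1\<close> the roots \<open>s\<close> of \<open>p(\<mu>, \<cdot>)\<close> are symmetric under the reflection \<open>s \<mapsto> - cnj s\<close> in the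
  imaginary axis. On the axis the cubic is self-inversive and has a unimodular root by the
  intermediate value theorem, so the whole axis belongs to the spectrum
  (\<open>imaginary_axis_in_spectrum\<close>).

  Necessity of \<open>\<Phi>\<^sub>3 = 0\<close>: a point of spectrum off the axis and its mirror image are two roots for the
  same \<open>\<mu>\<close>. When both collapse to \<open>s\<^sub>0\<close>, the divided difference of \<open>p\<close> between them tends to
  the derivative \<open>p\<^sub>s(\<mu>\<^sub>0, s\<^sub>0)\<close>, which therefore vanishes
  (\<open>off_axis_roots_accumulate_critical\<close>). This says \<open>f'(-s\<^sub>0) = - \<mu>\<^sub>0 f'(s\<^sub>0)\<close>, and substituting it turns
  \<open>\<Phi>\<^sub>3(s\<^sub>0)\<close> into \<open>f'(s\<^sub>0)\<^sup>3 p(\<mu>\<^sub>0, s\<^sub>0) = 0\<close>.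

  Sufficiency: if \<open>\<Phi>\<^sub>3(s\<^sub>0) = 0\<close>, then \<open>\<mu>\<^sub>0 = - f'(-s\<^sub>0) / f'(s\<^sub>0)\<close> is a critical multiplier. The
  discriminant of the cubic is \<open>\<Delta>\<^sub>3\<close>, so \<open>\<mu>\<^sub>0\<close> is a simple root and continues to a holomorphic
  multiplier \<open>m(s)\<close> (\<open>simple_multiplier_branch\<close>). Criticality means \<open>m'(s\<^sub>0) = 0\<close>, and the
  second-derivative condition means \<open>m''(s\<^sub>0) \<noteq> 0\<close>; hence \<open>m - \<mu>\<^sub>0\<close> is the square of a local coordinate
  with inverse \<open>\<psi>\<close>, that is \<open>m(\<psi>(w)) = \<mu>\<^sub>0 + w\<^sup>2\<close>
  (\<open>double_point_square_root_coordinate\<close>). The roots near \<open>s\<^sub>0\<close> are therefore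
  \<open>\<psi>(\<plusminus>\<surd>(\<mu> - \<mu>\<^sub>0))\<close>, which is the normal form with \<open>\<alpha> = \<psi>'(0)\<close>. By the reflection symmetry
  \<open>\<i> \<mu>\<^sub>0 \<alpha>\<^sup>2\<close> is real (\<open>critical_direction_real\<close>), so when \<open>\<mu>\<close> leaves \<open>\<mu>\<^sub>0\<close> along the circle in one of
  the two directions, the roots leave \<open>s\<^sub>0\<close> perpendicularly to the imaginary axis.
\<close>

no_notation fps_nth (infixl "$" 75)

section \<open>Analytic dependence of the monodromy matrix on the spectral parameter\<close>

lemma bounded_bilinear_matrix_mult:
  "bounded_bilinear ((**) :: complex^'n^'m \<Rightarrow> complex^'p^'n \<Rightarrow> complex^'p^'m)"
  unfolding bilinear_conv_bounded_bilinear [symmetric] bilinear_def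
  by (auto intro!: linearI simp: vec_eq_iff matrix_matrix_mult_def sum.distrib scaleR_sum_right
        distrib_left distrib_right)

text \<open>The weighted square \<open>exp (- 2 L x) |u x|\<^sup>2\<close> is nonincreasing.\<close>
lemma linear_gronwall:
  fixes u :: "real \<Rightarrow> 'a::real_inner"
  assumes der: "\<And>x. \<lbrakk>0 \<le> x; x \<le> t\<rbrakk> \<Longrightarrow> (u has_vector_derivative u' x) (at x)"
    and bound: "\<And>x. \<lbrakk>0 \<le> x; x \<le> t\<rbrakk> \<Longrightarrow> norm (u' x) \<le> L * norm (u x)"
    and "0 \<le> t"
  shows "norm (u t) \<le> exp (L * t) * norm (u 0)"
proof -
  define g where "g = (\<lambda>x. exp (- 2 * L * x) * (u x \<bullet> u x))"
  have "\<exists>y. (g has_real_derivative y) (at x) \<and> y \<le> 0" if "0 \<le> x" "x \<le> t" for x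
  proof -
    have "((\<lambda>x. u x \<bullet> u x) has_real_derivative (u x \<bullet> u' x + u' x \<bullet> u x)) (at x)"
      using bounded_bilinear.has_vector_derivative [OF bounded_bilinear_inner der der, OF that that]
      by (simp add: has_real_derivative_iff_has_vector_derivative)
    then have "(g has_real_derivative
        exp (- 2 * L * x) * (- 2 * L) * (u x \<bullet> u x) + exp (- 2 * L * x) * (u x \<bullet> u' x + u' x \<bullet> u x)) (at x)"
      unfolding g_def by (auto intro!: derivative_eq_intros)
    also have "exp (- 2 * L * x) * (- 2 * L) * (u x \<bullet> u x) + exp (- 2 * L * x) * (u x \<bullet> u' x + u' x \<bullet> u x)
        = 2 * exp (- 2 * L * x) * (u x \<bullet> u' x - L * (norm (u x))\<^sup>2)"
      by (simp add: algebra_simps inner_commute power2_norm_eq_inner)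
    finally have d: "(g has_real_derivative 2 * exp (- 2 * L * x) * (u x \<bullet> u' x - L * (norm (u x))\<^sup>2)) (at x)" .
    have "u x \<bullet> u' x \<le> norm (u x) * norm (u' x)"
      by (rule norm_cauchy_schwarz)
    also have "\<dots> \<le> norm (u x) * (L * norm (u x))"
      by (rule mult_left_mono [OF bound [OF that]]) simp
    finally have "u x \<bullet> u' x - L * (norm (u x))\<^sup>2 \<le> 0"
      by (simp add: power2_eq_square algebra_simps)
    then have "2 * exp (- 2 * L * x) * (u x \<bullet> u' x - L * (norm (u x))\<^sup>2) \<le> 0"
      by (intro mult_nonneg_nonpos) auto
    with d show ?thesis
      by blast
  qed
  then have "g t \<le> g 0"
    by (intro DERIV_nonpos_imp_nonincreasing [OF \<open>0 \<le> t\<close>]) blast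
  then have "exp (- 2 * L * t) * (norm (u t))\<^sup>2 \<le> (norm (u 0))\<^sup>2"
    by (simp add: g_def power2_norm_eq_inner)
  then have "exp (2 * L * t) * (exp (- 2 * L * t) * (norm (u t))\<^sup>2) \<le> exp (2 * L * t) * (norm (u 0))\<^sup>2"
    by (rule mult_left_mono) simp
  then have "(norm (u t))\<^sup>2 \<le> exp (2 * L * t) * (norm (u 0))\<^sup>2"
    by (simp add: mult.assoc [symmetric] exp_add [symmetric])
  also have "\<dots> = (exp (L * t) * norm (u 0))\<^sup>2"
    by (simp add: power_mult_distrib exp_double [symmetric] mult.assoc)
  finally show ?thesis
    by (rule power2_le_imp_le) simp
qed

text \<open>Explicit Euler steps of size \<open>h\<close> for the matrix equation \<open>X' = a X\<close>, \<open>X 0 = 1\<close>. The result is a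
  polynomial in the values of \<open>a\<close>, so it inherits from \<open>a\<close> both holomorphic dependence on a
  parameter and reality; both properties survive the limit \<open>h \<rightarrow> 0\<close>.\<close>
primrec euler :: "(real \<Rightarrow> complex^3^3) \<Rightarrow> real \<Rightarrow> nat \<Rightarrow> complex^3^3" where
  "euler a h 0 = mat 1"
| "euler a h (Suc k) = euler a h k + h *\<^sub>R (a (real k * h) ** euler a h k)"

text \<open>One step has local error at most \<open>h e\<close> because \<open>v'\<close> oscillates by at most \<open>e\<close> over a step, and it
  amplifies the error made so far by at most \<open>1 + L h \<le> exp (L h)\<close>.\<close>
lemma euler_error:
  fixes v :: "real \<Rightarrow> complex^3^3"
  assumes der: "\<And>x. (v has_vector_derivative (a x ** v x)) (at x)"
    and init: "v 0 = mat 1"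
    and bound: "\<And>x X. \<lbrakk>0 \<le> x; x \<le> T\<rbrakk> \<Longrightarrow> norm (a x ** (X :: complex^3^3)) \<le> L * norm X"
    and osc: "\<And>x y. \<lbrakk>0 \<le> x; x \<le> y; y \<le> x + h; y \<le> T\<rbrakk> \<Longrightarrow> norm (a y ** v y - a x ** v x) \<le> e"
    and "0 \<le> h" "0 \<le> L" "0 \<le> e" "real k * h \<le> T"
  shows "norm (v (real k * h) - euler a h k) \<le> e * (real k * h) * exp (L * (real k * h))"
  using \<open>real k * h \<le> T\<close>
proof (induction k)
  case 0
  then show ?case by (simp add: init)
next
  case (Suc k)
  define x where "x = real k * h"
  have x: "0 \<le> x" "real (Suc k) * h = x + h" "x + h \<le> T" "x \<le> T"
    using Suc.prems \<open>0 \<le> h\<close> by (auto simp: x_def algebra_simps)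
  define d where "d = v x - euler a h k"
  have IH: "norm d \<le> e * x * exp (L * x)"
    unfolding d_def using Suc.IH x by (simp add: x_def)
  have loc: "norm (v (x + h) - v x - (x + h - x) *\<^sub>R (a x ** v x)) \<le> norm (x + h - x) * e"
    by (rule vector_differentiable_bound_linearization [where S = "{x..x+h}"])
       (use x \<open>0 \<le> h\<close> der osc in \<open>auto intro: has_vector_derivative_at_within simp: closed_segment_eq_real_ivl\<close>)
  have "v (x + h) - euler a h (Suc k)
      = (v (x + h) - v x - h *\<^sub>R (a x ** v x)) + (d + h *\<^sub>R (a x ** d))"
    unfolding d_def euler.simps x_def [symmetric]
    by (simp add: bounded_bilinear.diff_right [OF bounded_bilinear_matrix_mult] algebra_simps)
  also have "norm \<dots> \<le> h * e + (norm d + h * (L * norm d))"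
    using loc bound [of x d] x \<open>0 \<le> h\<close>
    by (intro norm_triangle_le add_mono order.refl)
       (auto intro!: mult_left_mono)
  also have "\<dots> \<le> h * e + exp (L * h) * norm d"
    using mult_right_mono [OF exp_ge_add_one_self [of "L * h"], of "norm d"] by (simp add: algebra_simps)
  also have "\<dots> \<le> h * e * exp (L * (x + h)) + exp (L * h) * (e * x * exp (L * x))"
  proof (intro add_mono mult_left_mono IH)
    have "0 \<le> L * (x + h)" "0 \<le> h * e"
      using x assms(5-7) by auto
    then show "h * e \<le> h * e * exp (L * (x + h))"
      using mult_left_mono [of 1 "exp (L * (x + h))" "h * e"] by simp
  qed simp
  also have "\<dots> = e * (x + h) * exp (L * (x + h))"
    by (simp add: algebra_simps exp_add)
  finally show ?case
    using x by simp
qed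

lemma holomorphic_euler:
  fixes A :: "real \<Rightarrow> complex \<Rightarrow> complex^3^3"
  assumes "\<And>x i j. (\<lambda>s. A x s $ i $ j) holomorphic_on S"
  shows "(\<lambda>s. euler (\<lambda>x. A x s) h k $ i $ j) holomorphic_on S"
proof (induction k arbitrary: i j)
  case (Suc k)
  show ?case
    by (simp add: matrix_matrix_mult_def scaleR_conv_of_real[symmetric])
       (intro holomorphic_intros assms Suc.IH)
qed (simp add: mat_def)

lemma Reals_euler:
  fixes a :: "real \<Rightarrow> complex^3^3"
  assumes "\<And>x i j. a x $ i $ j \<in> \<real>"
  shows "euler a h k $ i $ j \<in> \<real>"
proof (induction k arbitrary: i j)
  case (Suc k)
  then show ?case
    using assms by (auto simp: matrix_matrix_mult_def scaleR_conv_of_real [where 'a = complex] intro!: Reals_add Reals_mult sum_in_Reals)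
qed (simp add: mat_def)

text \<open>Boundedness of \<open>V\<close> uniformly in \<open>s \<in> K\<close> comes from that of \<open>A\<close> on the compact set
  \<open>[0, T] \<times> K\<close> through the Gronwall estimate, before any continuity of \<open>V\<close> in \<open>s\<close> is established.\<close>
lemma fundamental_matrix_uniform_bounds:
  fixes A V :: "real \<Rightarrow> complex \<Rightarrow> complex^3^3"
  assumes fund: "fundamental_matrix A V"
    and cont: "continuous_on UNIV (\<lambda>(x, s). A x s)"
    and "T > 0" "compact K"
  obtains L B where "L > 0" "B > 0"
    "\<And>x s X. \<lbrakk>0 \<le> x; x \<le> T; s \<in> K\<rbrakk> \<Longrightarrow> norm (A x s ** (X :: complex^3^3)) \<le> L * norm X"
    "\<And>x s. \<lbrakk>0 \<le> x; x \<le> T; s \<in> K\<rbrakk> \<Longrightarrow> norm (V x s) \<le> B"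
proof -
  obtain C where C: "C > 0" "\<And>X Y. norm ((X :: complex^3^3) ** (Y :: complex^3^3)) \<le> norm X * norm Y * C"
    using bounded_bilinear.pos_bounded [OF bounded_bilinear_matrix_mult] by blast
  have "compact ((\<lambda>(x, s). A x s) ` ({0..T} \<times> K))"
    by (intro compact_continuous_image continuous_on_subset [OF cont] compact_Times assms) auto
  then obtain a where "a > 0" and "\<forall>y \<in> (\<lambda>(x, s). A x s) ` ({0..T} \<times> K). norm y \<le> a"
    using compact_imp_bounded bounded_pos by metis
  then have a: "norm (A x s) \<le> a" if "0 \<le> x" "x \<le> T" "s \<in> K" for x s
    using that by force
  define L where "L = a * C"
  define B where "B = exp (L * T) * norm (mat 1 :: complex^3^3)"
  have "L > 0"
    using C \<open>a > 0\<close> by (simp add: L_def)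
  have AL: "norm (A x s ** (X :: complex^3^3)) \<le> L * norm X" if "0 \<le> x" "x \<le> T" "s \<in> K" for x s X
  proof -
    have "norm (A x s ** X) \<le> norm (A x s) * norm X * C"
      by (rule C)
    also have "\<dots> \<le> a * norm X * C"
      using a that C by (intro mult_right_mono) auto
    finally show ?thesis
      by (simp add: L_def algebra_simps)
  qed
  have VB: "norm (V x s) \<le> B" if "0 \<le> x" "x \<le> T" "s \<in> K" for x s
  proof -
    have "norm (V x s) \<le> exp (L * x) * norm (V 0 s)"
      by (rule linear_gronwall [where u' = "\<lambda>y. A y s ** V y s"])
         (use fund AL that in \<open>auto simp: fundamental_matrix_def\<close>)
    also have "\<dots> \<le> B"
      using fund that \<open>L > 0\<close> by (auto simp: B_def fundamental_matrix_def intro!: mult_right_mono)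
    finally show ?thesis .
  qed
  have "(mat 1 :: complex^3^3) \<noteq> 0"
    by (simp add: vec_eq_iff mat_def)
  then have "B > 0"
    by (simp add: B_def)
  with that \<open>L > 0\<close> AL VB show thesis
    by blast
qed

text \<open>Only \<open>A\<close> is known to be uniformly continuous in \<open>(x, s)\<close>. The oscillation of \<open>V' = A V\<close> over a short
  step is nevertheless small uniformly in \<open>s\<close>, since \<open>V\<close> is Lipschitz in \<open>x\<close> with a constant
  that depends only on the uniform bounds.\<close>
lemma euler_uniform_limit:
  fixes A V :: "real \<Rightarrow> complex \<Rightarrow> complex^3^3"
  assumes fund: "fundamental_matrix A V"
    and cont: "continuous_on UNIV (\<lambda>(x, s). A x s)"
    and "T > 0" "compact K"
  shows "uniform_limit K (\<lambda>n s. euler (\<lambda>x. A x s) (T / real (Suc n)) (Suc n)) (V T) sequentially"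
proof (rule uniform_limitI)
  fix \<epsilon> :: real
  assume "\<epsilon> > 0"
  have der: "((\<lambda>y. V y s) has_vector_derivative (A x s ** V x s)) (at x)" and init: "V 0 s = mat 1" for x s
    using fund by (auto simp: fundamental_matrix_def)
  obtain L B where "L > 0" "B > 0"
    and AL: "\<And>x s X. \<lbrakk>0 \<le> x; x \<le> T; s \<in> K\<rbrakk> \<Longrightarrow> norm (A x s ** (X :: complex^3^3)) \<le> L * norm X"
    and VB: "\<And>x s. \<lbrakk>0 \<le> x; x \<le> T; s \<in> K\<rbrakk> \<Longrightarrow> norm (V x s) \<le> B"
    using fundamental_matrix_uniform_bounds [OF assms] by blast
  obtain C where C: "C > 0" "\<And>X Y. norm ((X :: complex^3^3) ** (Y :: complex^3^3)) \<le> norm X * norm Y * C"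
    using bounded_bilinear.pos_bounded [OF bounded_bilinear_matrix_mult] by blast
  \<comment> \<open>the factor that \<open>euler_error\<close> puts in front of the oscillation is \<open>T exp (L T)\<close>; half of \<open>\<epsilon>\<close>
    is kept back to obtain a strict inequality\<close>
  define e where "e = \<epsilon> / (2 * T * exp (L * T))"
  have "e > 0"
    using \<open>\<epsilon> > 0\<close> \<open>T > 0\<close> by (simp add: e_def)
  have "uniformly_continuous_on ({0..T} \<times> K) (\<lambda>(x, s). A x s)"
    by (intro compact_uniformly_continuous continuous_on_subset [OF cont] compact_Times assms) auto
  moreover have "e / (2 * B * C) > 0"
    using \<open>e > 0\<close> \<open>B > 0\<close> \<open>C > 0\<close> by simp
  ultimately obtain \<delta> where "\<delta> > 0" and \<delta>: "\<And>p q. \<lbrakk>p \<in> {0..T} \<times> K; q \<in> {0..T} \<times> K; dist q p < \<delta>\<rbrakk>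
      \<Longrightarrow> dist ((\<lambda>(x, s). A x s) q) ((\<lambda>(x, s). A x s) p) < e / (2 * B * C)"
    unfolding uniformly_continuous_on_def by metis
  define \<eta> where "\<eta> = min (\<delta> / 2) (e / (2 * L * (3 * L * B)))"
  have "\<eta> > 0"
    using \<open>\<delta> > 0\<close> \<open>e > 0\<close> \<open>L > 0\<close> \<open>B > 0\<close> by (simp add: \<eta>_def)
  have Lip: "norm (V y s - V x s) \<le> 3 * L * B * (y - x)" if "0 \<le> x" "x \<le> y" "y \<le> T" "s \<in> K" for x y s
  proof -
    have AVB: "norm (A z s ** V z s) \<le> L * B" if "0 \<le> z" "z \<le> T" for z
      using AL [of z s "V z s"] VB [of z s] that \<open>s \<in> K\<close> \<open>L > 0\<close>
      by (meson less_eq_real_def mult_left_mono order_trans)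
    have "norm (V y s - V x s - (y - x) *\<^sub>R (A x s ** V x s)) \<le> norm (y - x) * (2 * L * B)"
    proof (rule vector_differentiable_bound_linearization [where S = "{x..y}" and f' = "\<lambda>z. A z s ** V z s"])
      fix z assume "z \<in> {x..y}"
      then show "norm (A z s ** V z s - A x s ** V x s) \<le> 2 * L * B"
        using norm_triangle_ineq4 [of "A z s ** V z s" "A x s ** V x s"] AVB [of z] AVB [of x] that by auto
    qed (use that der in \<open>auto intro: has_vector_derivative_at_within simp: closed_segment_eq_real_ivl\<close>)
    moreover have "norm ((y - x) *\<^sub>R (A x s ** V x s)) \<le> (y - x) * (L * B)"
      using AVB [of x] that by (auto intro!: mult_left_mono)
    ultimately show ?thesis
      using norm_triangle_sub [of "V y s - V x s" "(y - x) *\<^sub>R (A x s ** V x s)"] that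
      by (simp add: algebra_simps)
  qed
  have osc: "norm (A y s ** V y s - A x s ** V x s) \<le> e"
    if "0 \<le> x" "x \<le> y" "y \<le> x + h" "y \<le> T" "s \<in> K" "h \<le> \<eta>" for x y s h
  proof -
    have "A y s ** V y s - A x s ** V x s = (A y s - A x s) ** V y s + A x s ** (V y s - V x s)"
      by (simp add: bounded_bilinear.diff_right [OF bounded_bilinear_matrix_mult]
          bounded_bilinear.diff_left [OF bounded_bilinear_matrix_mult])
    also have "norm \<dots> \<le> e / 2 + e / 2"
    proof (rule norm_triangle_mono)
      have "dist (y, s) (x, s) < \<delta>"
        using that \<open>\<eta> > 0\<close> \<open>\<delta> > 0\<close> by (auto simp: dist_Pair_Pair dist_real_def \<eta>_def)
      then have "norm (A y s - A x s) \<le> e / (2 * B * C)"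
        using \<delta> [of "(x, s)" "(y, s)"] that by (auto simp: dist_norm)
      then have "norm (A y s - A x s) * norm (V y s) * C \<le> e / (2 * B * C) * B * C"
        using VB [of y s] that \<open>e > 0\<close> \<open>B > 0\<close> \<open>C > 0\<close> by (intro mult_right_mono mult_mono) auto
      then show "norm ((A y s - A x s) ** V y s) \<le> e / 2"
        using C(2) [of "A y s - A x s" "V y s"] \<open>B > 0\<close> \<open>C > 0\<close> by (simp add: field_simps)
    next
      have "norm (A x s ** (V y s - V x s)) \<le> L * norm (V y s - V x s)"
        using AL that by auto
      also have "\<dots> \<le> L * (3 * L * B * (e / (2 * L * (3 * L * B))))"
      proof (intro mult_left_mono)
        have "y - x \<le> e / (2 * L * (3 * L * B))"
          using that by (auto simp: \<eta>_def)
        then show "norm (V y s - V x s) \<le> 3 * L * B * (e / (2 * L * (3 * L * B)))"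
          using Lip [of x y s] that \<open>L > 0\<close> \<open>B > 0\<close>
          by (smt (verit, best) mult_left_mono mult_pos_pos)
      qed (use \<open>L > 0\<close> in auto)
      also have "\<dots> = e / 2"
        using \<open>L > 0\<close> \<open>B > 0\<close> by (simp add: field_simps)
      finally show "norm (A x s ** (V y s - V x s)) \<le> e / 2" .
    qed
    finally show ?thesis by simp
  qed
  have "(\<lambda>n. T / real (Suc n)) \<longlonglongrightarrow> 0"
    by (intro tendsto_divide_0 [OF tendsto_const] filterlim_real_at_infinity_sequentially
        filterlim_compose [OF tendsto_of_nat] filterlim_at_top_imp_at_infinity
        filterlim_compose [OF filterlim_real_sequentially filterlim_Suc])
  then have "\<forall>\<^sub>F n in sequentially. T / real (Suc n) < \<eta>"
    using \<open>\<eta> > 0\<close> by (rule order_tendstoD)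
  then show "\<forall>\<^sub>F n in sequentially. \<forall>s\<in>K.
      dist (euler (\<lambda>x. A x s) (T / real (Suc n)) (Suc n)) (V T s) < \<epsilon>"
  proof eventually_elim
    case (elim n)
    show ?case
    proof
      fix s assume "s \<in> K"
      have nT: "real (Suc n) * (T / real (Suc n)) = T"
        by simp
      have "norm (V (real (Suc n) * (T / real (Suc n))) s - euler (\<lambda>x. A x s) (T / real (Suc n)) (Suc n))
          \<le> e * (real (Suc n) * (T / real (Suc n))) * exp (L * (real (Suc n) * (T / real (Suc n))))"
        by (rule euler_error [where v = "\<lambda>x. V x s"])
           (use der init AL osc elim \<open>s \<in> K\<close> \<open>T > 0\<close> \<open>L > 0\<close> \<open>e > 0\<close> nT in \<open>auto simp del: of_nat_Suc\<close>)
      then have "norm (V T s - euler (\<lambda>x. A x s) (T / real (Suc n)) (Suc n)) \<le> \<epsilon> / 2"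
        unfolding nT using \<open>T > 0\<close> by (simp add: e_def)
      then show "dist (euler (\<lambda>x. A x s) (T / real (Suc n)) (Suc n)) (V T s) < \<epsilon>"
        using \<open>\<epsilon> > 0\<close> by (simp add: dist_norm norm_minus_commute)
    qed
  qed
qed

lemma euler_entry_uniform_limit:
  fixes A V :: "real \<Rightarrow> complex \<Rightarrow> complex^3^3"
  assumes "fundamental_matrix A V" "continuous_on UNIV (\<lambda>(x, s). A x s)" "T > 0" "compact K"
  shows "uniform_limit K (\<lambda>n s. euler (\<lambda>x. A x s) (T / real (Suc n)) (Suc n) $ i $ j)
           (\<lambda>s. V T s $ i $ j) sequentially"
  by (intro bounded_linear.uniform_limit [OF bounded_linear_vec_nth] euler_uniform_limit [OF assms])

lemma fundamental_matrix_holomorphic: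
  fixes A V :: "real \<Rightarrow> complex \<Rightarrow> complex^3^3"
  assumes "fundamental_matrix A V" "continuous_on UNIV (\<lambda>(x, s). A x s)" "T > 0"
    and "\<And>x i j. (\<lambda>s. A x s $ i $ j) holomorphic_on UNIV"
  shows "(\<lambda>s. V T s $ i $ j) holomorphic_on UNIV"
proof (rule holomorphic_uniform_sequence [OF open_UNIV])
  show "(\<lambda>s. euler (\<lambda>x. A x s) (T / real (Suc n)) (Suc n) $ i $ j) holomorphic_on UNIV" for n
    by (rule holomorphic_euler [OF assms(4)])
  show "\<exists>d>0. cball z d \<subseteq> UNIV \<and> uniform_limit (cball z d)
      (\<lambda>n s. euler (\<lambda>x. A x s) (T / real (Suc n)) (Suc n) $ i $ j) (\<lambda>s. V T s $ i $ j) sequentially" for z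
    using euler_entry_uniform_limit [OF assms(1-3) compact_cball] zero_less_one by blast
qed

lemma fundamental_matrix_Reals:
  fixes A V :: "real \<Rightarrow> complex \<Rightarrow> complex^3^3"
  assumes "fundamental_matrix A V" "continuous_on UNIV (\<lambda>(x, s). A x s)" "T > 0"
    and real: "\<And>x i j. A x s $ i $ j \<in> \<real>"
  shows "V T s $ i $ j \<in> \<real>"
proof -
  have lim: "(\<lambda>n. euler (\<lambda>x. A x s) (T / real (Suc n)) (Suc n) $ i $ j) \<longlonglongrightarrow> V T s $ i $ j"
    by (rule tendsto_uniform_limitI [OF euler_entry_uniform_limit [OF assms(1-3), of "{s}"]]) auto
  show ?thesis
    by (rule closed_sequentially [OF closed_complex_Reals _ lim]) (rule Reals_euler [OF real])
qed

section \<open>Symmetries of the monodromy matrix\<close>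

text \<open>Liouville's formula \<open>(det V)' = tr A det V\<close>.\<close>
lemma det_fundamental_matrix:
  fixes A V :: "real \<Rightarrow> complex \<Rightarrow> complex^3^3"
  assumes fund: "fundamental_matrix A V" and trace: "\<And>x. trace (A x s) = 0"
  shows "det (V x s) = 1"
proof -
  have entry: "((\<lambda>y. V y s $ i $ j) has_vector_derivative (\<Sum>k\<in>UNIV. A x s $ i $ k * V x s $ k $ j)) (at x)"
    for i j x
  proof -
    have "((\<lambda>y. V y s) has_vector_derivative (A x s ** V x s)) (at x)"
      using fund by (simp add: fundamental_matrix_def)
    then have "((\<lambda>y. V y s $ i $ j) has_vector_derivative (A x s ** V x s) $ i $ j) (at x)"
      by (intro bounded_linear.has_vector_derivative [OF bounded_linear_vec_nth])
    then show ?thesis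
      by (simp add: matrix_matrix_mult_def)
  qed
  have "((\<lambda>y. det (V y s)) has_vector_derivative trace (A x s) * det (V x s)) (at x)" for x
    unfolding det_3 trace_def
    by (rule has_vector_derivative_eq_rhs, (rule derivative_intros entry)+)
       (simp add: sum_3 algebra_simps)
  then have "((\<lambda>y. det (V y s)) has_vector_derivative 0) (at x within UNIV)" for x
    by (simp add: trace)
  then obtain c where "\<And>x. det (V x s) = c"
    using has_vector_derivative_zero_constant [OF convex_UNIV, of "\<lambda>y. det (V y s)"] by auto
  moreover have "det (V 0 s) = 1"
    using fund by (simp add: fundamental_matrix_def)
  ultimately show ?thesis
    by metis
qed

text \<open>The derivative of \<open>V(x, s)\<^sup>T B V(x, -s)\<close> is \<open>V\<^sup>T (A\<^sup>T B + B A(-s)) V(-s) = 0\<close>.\<close>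
lemma fundamental_matrix_conjugation:
  fixes A V :: "real \<Rightarrow> complex \<Rightarrow> complex^3^3"
  assumes fund: "fundamental_matrix A V"
    and A2: "\<And>x. transpose (A x s) ** B = - (B ** A x (-s))"
  shows "transpose (V x s) ** B ** V x (-s) = B"
proof -
  have blt: "bounded_linear (transpose :: complex^3^3 \<Rightarrow> complex^3^3)"
    unfolding linear_conv_bounded_linear [symmetric]
    by (auto intro!: linearI simp: vec_eq_iff transpose_def)
  have der: "((\<lambda>y. V y r) has_vector_derivative (A x r ** V x r)) (at x)" for x r
    using fund by (simp add: fundamental_matrix_def)
  have "((\<lambda>y. transpose (V y s) ** (B ** V y (-s))) has_vector_derivative
      transpose (V x s) ** (B ** (A x (-s) ** V x (-s))) + transpose (A x s ** V x s) ** (B ** V x (-s))) (at x)"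
    for x
    by (intro bounded_bilinear.has_vector_derivative [OF bounded_bilinear_matrix_mult]
        bounded_linear.has_vector_derivative [OF blt] der
        bounded_linear.has_vector_derivative
          [OF bounded_bilinear.bounded_linear_right [OF bounded_bilinear_matrix_mult]])
  moreover have "transpose (V x s) ** (B ** (A x (-s) ** V x (-s)))
      + transpose (A x s ** V x s) ** (B ** V x (-s)) = 0" for x
  proof -
    have "transpose (A x s ** V x s) ** (B ** V x (-s))
        = transpose (V x s) ** ((transpose (A x s) ** B) ** V x (-s))"
      by (simp add: matrix_transpose_mul matrix_mul_assoc)
    also have "\<dots> = - (transpose (V x s) ** (B ** (A x (-s) ** V x (-s))))"
      by (simp add: A2 matrix_mul_assoc bounded_bilinear.minus_left [OF bounded_bilinear_matrix_mult]
          bounded_bilinear.minus_right [OF bounded_bilinear_matrix_mult])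
    finally show ?thesis by simp
  qed
  ultimately have "((\<lambda>y. transpose (V y s) ** (B ** V y (-s))) has_vector_derivative 0) (at x within UNIV)" for x
    by simp
  then obtain C where "\<And>x. transpose (V x s) ** (B ** V x (-s)) = C"
    using has_vector_derivative_zero_constant [OF convex_UNIV, of "\<lambda>y. transpose (V y s) ** (B ** V y (-s))"]
    by auto
  moreover have "transpose (V 0 s) ** (B ** V 0 (-s)) = B"
    using fund by (simp add: fundamental_matrix_def)
  ultimately show ?thesis
    by (metis matrix_mul_assoc)
qed

text \<open>The second elementary symmetric function of the eigenvalues.\<close>
definition minor_trace :: "complex^3^3 \<Rightarrow> complex" where
  "minor_trace X = (X$1$1 * X$2$2 - X$1$2 * X$2$1) + (X$1$1 * X$3$3 - X$1$3 * X$3$1)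
     + (X$2$2 * X$3$3 - X$2$3 * X$3$2)"

lemma det_minus_scalar:
  "det (X - mat \<mu>) = det X - minor_trace X * \<mu> + trace X * \<mu>\<^sup>2 - \<mu>^3"
  by (simp add: det_3 minor_trace_def trace_def sum_3 mat_def power2_eq_square power3_eq_cube algebra_simps)

text \<open>If \<open>X\<^sup>T B Y = B\<close> with \<open>B\<close> invertible, then \<open>Y\<close> is similar to the inverse of \<open>X\<^sup>T\<close>, and for
  determinant one the trace of the inverse is the sum of the principal minors. Instead of inverting,
  the proof factors \<open>(X\<^sup>T + c) B = X\<^sup>T B (1 + c Y)\<close> and compares determinants at \<open>c = \<plusminus>1\<close>, which
  determines both middle coefficients of the characteristic polynomials.\<close>
lemma minor_trace_eq_trace:
  fixes X B Y :: "complex^3^3"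
  assumes "transpose X ** B ** Y = B" "invertible B" "det X = 1" "det Y = 1"
  shows "minor_trace X = trace Y"
proof -
  have B: "det B \<noteq> 0"
    using \<open>invertible B\<close> by (simp add: invertible_det_nz)
  have shift: "det (X + c *\<^sub>R mat 1) = det (mat 1 + c *\<^sub>R Y)" for c :: real
  proof -
    have "(transpose X + c *\<^sub>R mat 1) ** B = transpose X ** B ** (mat 1 + c *\<^sub>R Y)"
      using assms(1)
      by (simp add: bounded_bilinear.add_left [OF bounded_bilinear_matrix_mult]
          bounded_bilinear.add_right [OF bounded_bilinear_matrix_mult]
          bounded_bilinear.scaleR_left [OF bounded_bilinear_matrix_mult]
          bounded_bilinear.scaleR_right [OF bounded_bilinear_matrix_mult])
    then have "det (transpose X + c *\<^sub>R mat 1) * det B = det (transpose X ** B ** (mat 1 + c *\<^sub>R Y))"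
      by (metis det_mul)
    then have "det (transpose X + c *\<^sub>R mat 1) = det (mat 1 + c *\<^sub>R Y)"
      using B \<open>det X = 1\<close> by (simp add: det_mul)
    moreover have "transpose X + c *\<^sub>R mat 1 = transpose (X + c *\<^sub>R mat 1)"
      by (simp add: vec_eq_iff transpose_def mat_def)
    ultimately show ?thesis
      by simp
  qed
  have m: "mat 1 + (-1) *\<^sub>R Y = - (Y - mat 1)" "X + (-1) *\<^sub>R mat 1 = X - mat 1"
    "mat 1 + 1 *\<^sub>R Y = Y - mat (-1)" "X + 1 *\<^sub>R mat 1 = X - mat (-1)"
    by (auto simp: vec_eq_iff mat_def)
  have "det (- Z) = - det Z" for Z :: "complex^3^3"
    by (simp add: det_3 algebra_simps)
  then have "det (X - mat 1) = - det (Y - mat 1)"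
    using shift [of "-1"] unfolding m by metis
  moreover have "det (X - mat (-1)) = det (Y - mat (-1))"
    using shift [of 1] unfolding m by simp
  ultimately have "trace X + trace Y = minor_trace X + minor_trace Y"
      "trace X + minor_trace X = trace Y + minor_trace Y"
    using assms(3,4) by (auto simp: det_minus_scalar algebra_simps)
  then have "2 * minor_trace X = 2 * trace Y"
    by algebra
  then show ?thesis
    by simp
qed

lemma holomorphic_minor_trace:
  fixes M :: "complex \<Rightarrow> complex^3^3"
  assumes "\<And>i j. (\<lambda>s. M s $ i $ j) holomorphic_on S"
  shows "(\<lambda>s. minor_trace (M s)) holomorphic_on S"
  unfolding minor_trace_def by (intro holomorphic_intros assms)

lemma holomorphic_trace:
  fixes M :: "complex \<Rightarrow> complex^3^3"
  assumes "\<And>i j. (\<lambda>s. M s $ i $ j) holomorphic_on S"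
  shows "(\<lambda>s. trace (M s)) holomorphic_on S"
  unfolding trace_def by (intro holomorphic_intros assms)

lemma eq_off_finite_imp_eq:
  fixes f g :: "complex \<Rightarrow> complex"
  assumes "continuous_on UNIV f" "continuous_on UNIV g" "finite F" "\<And>s. s \<notin> F \<Longrightarrow> f s = g s"
  shows "f s = g s"
proof -
  have "s islimpt - F"
    using \<open>finite F\<close> by (metis islimpt_UNIV islimpt_Un islimpt_finite Compl_partition)
  then have "s \<in> closure (- F)"
    by (simp add: closure_def)
  moreover have "continuous_on (closure (- F)) (\<lambda>s. f s - g s)"
    using assms(1,2) by (intro continuous_on_diff) (auto intro: continuous_on_subset)
  ultimately have "f s - g s = 0"
    using continuous_constant_on_closure [of "- F" "\<lambda>s. f s - g s" 0 s] assms(4) by simp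
  then show ?thesis by simp
qed

text \<open>Where \<open>B s\<close> is invertible this is the previous computation; at the finitely many
  remaining parameters it follows by continuity, because both sides are entire.\<close>
lemma monodromy_floquet_poly:
  fixes A V :: "real \<Rightarrow> complex \<Rightarrow> complex^3^3"
  assumes T_pos: "T > 0"
    and cont: "continuous_on UNIV (\<lambda>(x, s). A x s)"
    and entire: "\<And>x i j. (\<lambda>s. A x s $ i $ j) holomorphic_on UNIV"
    and A2: "\<exists>B :: complex \<Rightarrow> complex^3^3.
               (\<forall>x s. transpose (A x s) ** B s = - (B s ** A x (-s))) \<and>
               finite {s. \<not> invertible (B s)}"
    and trace_zero: "\<And>x s. trace (A x s) = 0"
    and fund: "fundamental_matrix A V"
  shows "floquet_poly (V T) \<mu> s = 1 - trace (V T (-s)) * \<mu> + trace (V T s) * \<mu>\<^sup>2 - \<mu>^3"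
proof -
  obtain B :: "complex \<Rightarrow> complex^3^3" where
    B: "\<And>x s. transpose (A x s) ** B s = - (B s ** A x (-s))" "finite {s. \<not> invertible (B s)}"
    using A2 by blast
  have hol: "(\<lambda>s. V T s $ i $ j) holomorphic_on UNIV" for i j
    by (rule fundamental_matrix_holomorphic [OF fund cont T_pos entire])
  have "(\<lambda>s. V T (-s) $ i $ j) holomorphic_on UNIV" for i j
    using holomorphic_on_compose [OF _ holomorphic_on_subset [OF hol], of uminus UNIV i j]
    by (simp add: o_def holomorphic_on_minus)
  then have "continuous_on UNIV (\<lambda>s. minor_trace (V T s))" "continuous_on UNIV (\<lambda>s. trace (V T (-s)))"
    using hol by (intro holomorphic_on_imp_continuous_on holomorphic_minor_trace holomorphic_trace; blast)+
  moreover have "minor_trace (V T s) = trace (V T (-s))" if "s \<notin> {s. \<not> invertible (B s)}" for s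
    using that det_fundamental_matrix [OF fund trace_zero]
      fundamental_matrix_conjugation [OF fund B(1)]
    by (intro minor_trace_eq_trace [where B = "B s"]) auto
  ultimately have "minor_trace (V T s) = trace (V T (-s))"
    by (rule eq_off_finite_imp_eq [OF _ _ B(2)])
  then show ?thesis
    by (simp add: floquet_poly_def det_minus_scalar det_fundamental_matrix [OF fund trace_zero])
qed

text \<open>The functions \<open>f\<close> and \<open>cnj \<circ> f \<circ> cnj\<close> are entire and agree on the real line.\<close>
lemma reflection_of_real_entire:
  assumes "f holomorphic_on UNIV" "\<And>s. s \<in> \<real> \<Longrightarrow> f s \<in> \<real>"
  shows "f (cnj s) = cnj (f s)"
proof -
  have "(\<lambda>s. f s - (cnj \<circ> f \<circ> cnj) s) holomorphic_on UNIV"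
    using assms(1) by (intro holomorphic_intros holomorphic_on_compose_cnj_cnj) auto
  moreover have "0 islimpt (\<real> :: complex set)"
    unfolding islimpt_approachable
  proof (intro allI impI)
    fix e :: real assume "e > 0"
    then show "\<exists>x'\<in>\<real>. x' \<noteq> 0 \<and> dist x' (0 :: complex) < e"
      by (intro bexI [where x = "of_real (e / 2)"]) auto
  qed
  moreover have "f x - (cnj \<circ> f \<circ> cnj) x = 0" if "x \<in> \<real>" for x
    using that assms(2) [OF that] by (auto simp: Reals_cnj_iff)
  ultimately have "f s - (cnj \<circ> f \<circ> cnj) s = 0"
    using analytic_continuation [of "\<lambda>s. f s - (cnj \<circ> f \<circ> cnj) s" UNIV \<real> 0 s] by auto
  then have "cnj (f s) = cnj (cnj (f (cnj s)))"
    by simp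
  then show ?thesis by simp
qed

section \<open>The Floquet cubic\<close>

definition floquet_cubic :: "(complex \<Rightarrow> complex) \<Rightarrow> complex \<Rightarrow> complex \<Rightarrow> complex" where
  "floquet_cubic f \<mu> s = 1 - f (-s) * \<mu> + f s * \<mu>\<^sup>2 - \<mu>^3"

text \<open>For \<open>\<mu> = u\<^sup>2\<close> with \<open>|u| = 1\<close>, dividing the cubic by \<open>u\<^sup>3\<close> leaves \<open>2 \<i> Im (z u - u\<^sup>3)\<close>. This function is
  odd in \<open>u\<close>, so it changes sign along a half circle.\<close>
lemma self_inversive_cubic_unimodular_root:
  fixes z :: complex
  obtains \<mu> where "norm \<mu> = 1" "1 - cnj z * \<mu> + z * \<mu>\<^sup>2 - \<mu>^3 = 0"
proof -
  define h where "h = (\<lambda>t. Im (z * cis t - cis t ^ 3))"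
  have cont: "continuous_on {0..pi} h"
    unfolding h_def by (intro continuous_intros)
  have "h pi = - h 0"
    by (simp add: h_def cis_pi)
  have "\<exists>t. h t = 0"
  proof (cases "h 0 \<le> 0")
    case True
    then show ?thesis
      using IVT' [of h 0 0 pi] cont \<open>h pi = - h 0\<close> pi_ge_zero by auto
  next
    case False
    then show ?thesis
      using IVT2' [of h pi 0 0] cont \<open>h pi = - h 0\<close> pi_ge_zero by auto
  qed
  then obtain t where "h t = 0" ..
  define u where "u = cis t"
  have u: "u * cnj u = 1"
    by (simp add: u_def cis_cnj cis_mult)
  have "cnj w = w" if "Im w = 0" for w
    using that by (simp add: complex_eq_iff)
  then have "cnj (z * u - u ^ 3) = z * u - u ^ 3"
    using \<open>h t = 0\<close> unfolding h_def u_def by blast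
  then have eq: "cnj z * cnj u - cnj u ^ 3 = z * u - u ^ 3"
    by simp
  have "1 - cnj z * u\<^sup>2 + z * (u\<^sup>2)\<^sup>2 - (u\<^sup>2)^3
      = (u * cnj u) ^ 3 - cnj z * u\<^sup>2 * (u * cnj u) + z * (u\<^sup>2)\<^sup>2 - (u\<^sup>2)^3"
    by (simp add: u)
  also have "\<dots> = u ^ 3 * ((z * u - u ^ 3) - (cnj z * cnj u - cnj u ^ 3))"
    by algebra
  also have "\<dots> = 0"
    by (simp add: eq)
  finally show thesis
    using that [of "u\<^sup>2"] by (simp add: u_def norm_power)
qed

text \<open>The two equations express \<open>a\<close> and \<open>b\<close> through the double root, and the discriminant vanishes
  identically after substitution.\<close>
lemma cubic_double_root_discriminant:
  fixes a b \<mu> :: complex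
  assumes "1 - b * \<mu> + a * \<mu>\<^sup>2 - \<mu>^3 = 0" "- b + 2 * a * \<mu> - 3 * \<mu>\<^sup>2 = 0"
  shows "a\<^sup>2 * b\<^sup>2 - 4 * a^3 - 4 * b^3 + 18 * a * b - 27 = 0"
proof -
  have "\<mu> \<noteq> 0"
    using assms(1) by auto
  have "a * \<mu>\<^sup>2 = 1 + 2 * \<mu>^3" "b * \<mu> = 2 + \<mu>^3"
    using assms by algebra+
  then have a: "a = (1 + 2 * \<mu>^3) / \<mu>\<^sup>2" and b: "b = (2 + \<mu>^3) / \<mu>"
    using \<open>\<mu> \<noteq> 0\<close> by (simp_all add: field_simps)
  show ?thesis
    unfolding a b using \<open>\<mu> \<noteq> 0\<close> by (simp add: field_simps) algebra
qed

text \<open>A holomorphic function is strictly differentiable: difference quotients converge to the derivative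
  even when both endpoints move. This holds because \<open>f - f'(z) \<cdot> id\<close> has an arbitrarily small Lipschitz
  constant near \<open>z\<close>.\<close>
lemma strict_derivative_sequence:
  fixes f :: "complex \<Rightarrow> complex"
  assumes hol: "f holomorphic_on S" and "open S" "z \<in> S"
    and "x \<longlonglongrightarrow> z" "y \<longlonglongrightarrow> z" "\<And>n. x n \<noteq> y n"
  shows "(\<lambda>n. (f (x n) - f (y n)) / (x n - y n)) \<longlonglongrightarrow> deriv f z"
proof (rule LIMSEQ_I)
  fix e :: real assume "e > 0"
  have "isCont (deriv f) z"
    using holomorphic_deriv [OF hol \<open>open S\<close>] \<open>open S\<close> \<open>z \<in> S\<close>
    by (metis continuous_on_eq_continuous_at holomorphic_on_imp_continuous_on)
  then obtain d1 where "d1 > 0" and d1: "\<And>w. dist w z < d1 \<Longrightarrow> dist (deriv f w) (deriv f z) < e / 2"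
    using \<open>e > 0\<close> unfolding continuous_at_eps_delta dist_norm by (metis half_gt_zero)
  obtain d2 where "d2 > 0" "ball z d2 \<subseteq> S"
    using \<open>open S\<close> \<open>z \<in> S\<close> open_contains_ball by blast
  define d where "d = min d1 d2"
  have "d > 0"
    using \<open>d1 > 0\<close> \<open>d2 > 0\<close> by (simp add: d_def)
  have bound: "norm ((f v - deriv f z * v) - (f w - deriv f z * w)) \<le> e / 2 * norm (v - w)"
    if "v \<in> ball z d" "w \<in> ball z d" for v w
  proof (rule field_differentiable_bound [OF convex_ball _ _ that])
    fix u assume u: "u \<in> ball z d"
    then have "u \<in> S"
      using \<open>ball z d2 \<subseteq> S\<close> by (auto simp: d_def)
    then show "((\<lambda>v. f v - deriv f z * v) has_field_derivative (deriv f u - deriv f z)) (at u within ball z d)"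
      using holomorphic_derivI [OF hol \<open>open S\<close>] by (auto intro!: derivative_eq_intros)
    show "norm (deriv f u - deriv f z) \<le> e / 2"
      using d1 [of u] u by (simp add: d_def dist_norm norm_minus_commute)
  qed
  have "\<forall>\<^sub>F n in sequentially. dist (x n) z < d" "\<forall>\<^sub>F n in sequentially. dist (y n) z < d"
    using assms(4,5) \<open>d > 0\<close> by (auto dest: tendstoD)
  then have "\<forall>\<^sub>F n in sequentially. norm ((f (x n) - f (y n)) / (x n - y n) - deriv f z) < e"
  proof eventually_elim
    case (elim n)
    have "norm ((f (x n) - f (y n)) - deriv f z * (x n - y n)) \<le> e / 2 * norm (x n - y n)"
      using bound [of "x n" "y n"] elim by (simp add: dist_commute algebra_simps)
    moreover have "(f (x n) - f (y n)) / (x n - y n) - deriv f z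
        = ((f (x n) - f (y n)) - deriv f z * (x n - y n)) / (x n - y n)"
      using assms(6) [of n] by (simp add: field_simps)
    ultimately have "norm ((f (x n) - f (y n)) / (x n - y n) - deriv f z) \<le> e / 2"
      using assms(6) [of n] by (simp add: norm_divide divide_le_eq)
    then show ?case
      using \<open>e > 0\<close> by simp
  qed
  then show "\<exists>n0. \<forall>n\<ge>n0. norm ((f (x n) - f (y n)) / (x n - y n) - deriv f z) < e"
    by (simp add: eventually_sequentially)
qed

lemma DERIV_compose_uminus:
  fixes h h' :: "complex \<Rightarrow> complex"
  assumes "\<And>s. (h has_field_derivative h' s) (at s)"
  shows "((\<lambda>s. h (-s)) has_field_derivative - h' (-s)) (at s)"
proof -
  have "(uminus has_field_derivative -1) (at s)"
    by (auto intro!: derivative_eq_intros)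
  from DERIV_chain' [OF this assms] show ?thesis
    by simp
qed

text \<open>From here on the analysis uses the trace \<open>f\<close> of the monodromy matrix only through these
  two properties.\<close>
locale reflection_symmetric_entire =
  fixes f :: "complex \<Rightarrow> complex"
  assumes hol: "f holomorphic_on UNIV"
    and refl: "\<And>s. f (cnj s) = cnj (f s)"
begin

lemma tendsto_compose_entire: "(g \<longlongrightarrow> l) F \<Longrightarrow> ((\<lambda>x. f (g x)) \<longlongrightarrow> f l) F"
  using hol by (metis UNIV_I continuous_on_def holomorphic_on_imp_continuous_on isCont_def
      isCont_tendsto_compose open_UNIV tendsto_within_open)

lemma DERIV_f: "(f has_field_derivative deriv f s) (at s)"
  by (rule holomorphic_derivI [OF hol]) auto

lemma DERIV_cubic:
  "((\<lambda>s. floquet_cubic f \<mu> s) has_field_derivative (deriv f (-s) * \<mu> + deriv f s * \<mu>\<^sup>2)) (at s)"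
  unfolding floquet_cubic_def
  by (auto intro!: derivative_eq_intros DERIV_f DERIV_compose_uminus [OF DERIV_f])

lemma axis_reflection: "Re s = 0 \<Longrightarrow> f (-s) = cnj (f s)"
  using refl [of s] by (metis complex_cnj_cancel_iff complex_eq_iff complex_cnj add.inverse_neutral uminus_complex.simps cnj.simps)

lemma deriv_reflection: "deriv f (cnj s) = cnj (deriv f s)"
proof -
  have "((cnj \<circ> f \<circ> cnj) has_field_derivative cnj (deriv f s)) (at (cnj s))"
    by (rule has_field_derivative_cnj_cnj) (simp add: DERIV_f)
  moreover have "cnj \<circ> f \<circ> cnj = f"
    by (auto simp: refl)
  ultimately show ?thesis
    by (simp add: DERIV_imp_deriv)
qed

lemma cubic_reflection:
  assumes "norm \<mu> = 1"
  shows "floquet_cubic f \<mu> (- cnj s) = - (\<mu>^3) * cnj (floquet_cubic f \<mu> s)"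
proof -
  have u: "\<mu> * cnj \<mu> = 1"
    using assms by (simp add: complex_norm_square [symmetric])
  have "floquet_cubic f \<mu> (- cnj s) = 1 - cnj (f s) * \<mu> + cnj (f (-s)) * \<mu>\<^sup>2 - \<mu>^3"
    using refl [of "-s"] by (simp add: floquet_cubic_def refl)
  also have "\<dots> = (\<mu> * cnj \<mu>)^3 - cnj (f s) * \<mu> * (\<mu> * cnj \<mu>)\<^sup>2 + cnj (f (-s)) * \<mu>\<^sup>2 * (\<mu> * cnj \<mu>) - \<mu>^3"
    by (simp add: u)
  also have "\<dots> = - (\<mu>^3) * cnj (floquet_cubic f \<mu> s)"
    by (simp add: floquet_cubic_def) algebra
  finally show ?thesis .
qed

text \<open>Each root \<open>X n\<close> off the axis comes with the mirror root \<open>- cnj (X n)\<close> of the same cubic. Both tend to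
  \<open>s0\<close>, so the divided difference of the cubic between them, which is zero, converges to its
  derivative at a limit point of the multipliers.\<close>
lemma off_axis_roots_accumulate_critical:
  assumes "Re s0 = 0" "X \<longlonglongrightarrow> s0" "\<And>n. Re (X n) \<noteq> 0"
    and norm: "\<And>n. norm (\<mu> n) = 1" and root: "\<And>n. floquet_cubic f (\<mu> n) (X n) = 0"
  obtains \<mu>0 where "norm \<mu>0 = 1" "floquet_cubic f \<mu>0 s0 = 0" "deriv f (-s0) + deriv f s0 * \<mu>0 = 0"
proof -
  have "seq_compact (sphere (0::complex) 1)"
    by (simp add: compact_imp_seq_compact)
  then obtain \<mu>0 k where "\<mu>0 \<in> sphere 0 1" and k: "strict_mono k" "(\<mu> \<circ> k) \<longlonglongrightarrow> \<mu>0"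
    using norm by (metis (no_types, lifting) mem_sphere_0 seq_compactE)
  define x where "x = X \<circ> k"
  define y where "y = (\<lambda>n. - cnj (x n))"
  define m where "m = \<mu> \<circ> k"
  have "norm \<mu>0 = 1" "\<mu>0 \<noteq> 0"
    using \<open>\<mu>0 \<in> sphere 0 1\<close> by auto
  have x: "x \<longlonglongrightarrow> s0"
    unfolding x_def by (rule LIMSEQ_subseq_LIMSEQ [OF assms(2) k(1)])
  have m: "m \<longlonglongrightarrow> \<mu>0"
    using k by (simp add: m_def)
  have "- cnj s0 = s0"
    using \<open>Re s0 = 0\<close> by (simp add: complex_eq_iff)
  then have y: "y \<longlonglongrightarrow> s0"
    unfolding y_def using x by (metis tendsto_cnj tendsto_minus)
  have xy: "x n \<noteq> y n" for n
    using assms(3) [of "k n"] by (auto simp: x_def y_def complex_eq_iff)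
  have px: "floquet_cubic f (m n) (x n) = 0" for n
    using root by (simp add: x_def m_def)
  have py: "floquet_cubic f (m n) (y n) = 0" for n
    using cubic_reflection [of "m n" "x n"] px norm by (simp add: y_def m_def)
  have "(\<lambda>n. floquet_cubic f (m n) (x n)) \<longlonglongrightarrow> floquet_cubic f \<mu>0 s0"
    unfolding floquet_cubic_def by (intro tendsto_intros tendsto_compose_entire x m)
  then have "floquet_cubic f \<mu>0 s0 = 0"
    using px LIMSEQ_unique by (simp add: LIMSEQ_const_iff)
  have lim1: "(\<lambda>n. (f (x n) - f (y n)) / (x n - y n)) \<longlonglongrightarrow> deriv f s0"
    by (rule strict_derivative_sequence [OF hol]) (use x y xy in auto)
  have lim2: "(\<lambda>n. (f (- x n) - f (- y n)) / (- x n - - y n)) \<longlonglongrightarrow> deriv f (- s0)"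
    by (rule strict_derivative_sequence [OF hol]) (use x y xy in \<open>auto intro: tendsto_minus\<close>)
  have "(f (- x n) - f (- y n)) / (- x n - - y n) + (f (x n) - f (y n)) / (x n - y n) * m n = 0" for n
  proof -
    have "m n \<noteq> 0"
      using norm [of "k n"] by (auto simp: m_def)
    have "m n * ((f (- x n) - f (- y n)) - (f (x n) - f (y n)) * m n) = 0"
      using px [of n] py [of n] unfolding floquet_cubic_def by algebra
    then have e: "f (- x n) - f (- y n) = (f (x n) - f (y n)) * m n"
      using \<open>m n \<noteq> 0\<close> by simp
    have "- x n - - y n = - (x n - y n)"
      by simp
    then show ?thesis
      unfolding e by (simp only: minus_divide_right [symmetric]) (simp add: divide_simps)
  qed
  moreover have "(\<lambda>n. (f (- x n) - f (- y n)) / (- x n - - y n) + (f (x n) - f (y n)) / (x n - y n) * m n)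
      \<longlonglongrightarrow> deriv f (- s0) + deriv f s0 * \<mu>0"
    by (intro tendsto_intros lim1 lim2 m)
  ultimately have "deriv f (- s0) + deriv f s0 * \<mu>0 = 0"
    using LIMSEQ_unique by (simp add: LIMSEQ_const_iff)
  with that \<open>norm \<mu>0 = 1\<close> \<open>floquet_cubic f \<mu>0 s0 = 0\<close> show thesis
    by blast
qed

text \<open>The criticality condition eliminates \<open>f'(-s)\<close>; then \<open>\<Phi>\<^sub>3\<close> is the cubic itself up to the factor
  \<open>f'(s)\<^sup>3\<close>.\<close>
lemma Phi3_eq_cubic:
  assumes "deriv f (-s) + deriv f s * \<mu> = 0"
  shows "Phi3 f s = deriv f s ^ 3 * floquet_cubic f \<mu> s"
proof -
  have "deriv f (-s) = - (deriv f s * \<mu>)"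
    using assms by (simp add: eq_neg_iff_add_eq_0)
  then show ?thesis
    unfolding Phi3_def floquet_cubic_def by (simp add: algebra_simps power2_eq_square power3_eq_cube)
qed

lemma bifurcation_imp_Phi3_eq_0:
  assumes "Re s0 = 0"
    and bif: "bifurcates_off_axis {s. \<exists>\<mu>. norm \<mu> = 1 \<and> floquet_cubic f \<mu> s = 0} s0"
  shows "Phi3 f s0 = 0"
proof -
  from bif obtain g where g: "path g" "pathstart g = s0"
      and on: "path_image g \<subseteq> {s. \<exists>\<mu>. norm \<mu> = 1 \<and> floquet_cubic f \<mu> s = 0}"
      and off: "\<And>t. t \<in> {0<..1} \<Longrightarrow> g t \<notin> imaginary_axis"
    unfolding bifurcates_off_axis_def by blast
  define X where "X = (\<lambda>n. g (inverse (real (Suc n))))"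
  have in01: "inverse (real (Suc n)) \<in> {0<..1}" for n
    by (auto simp: inverse_le_1_iff)
  have "continuous_on {0..1} g"
    using g by (simp add: path_def)
  then have "X \<longlonglongrightarrow> g 0"
    unfolding X_def
    by (rule continuous_on_tendsto_compose [OF _ LIMSEQ_inverse_real_of_nat])
       (use in01 in \<open>auto intro!: always_eventually simp: less_imp_le\<close>)
  then have "X \<longlonglongrightarrow> s0"
    using g by (simp add: pathstart_def)
  moreover have "Re (X n) \<noteq> 0" for n
    using off [OF in01] by (simp add: X_def imaginary_axis_def)
  moreover have "\<exists>\<mu>. norm \<mu> = 1 \<and> floquet_cubic f \<mu> (X n) = 0" for n
  proof -
    have "X n \<in> path_image g"
      unfolding X_def path_image_def using in01 [of n] by (intro imageI) auto
    with on show ?thesis by blast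
  qed
  then obtain \<mu> where "\<And>n. norm (\<mu> n) = 1" "\<And>n. floquet_cubic f (\<mu> n) (X n) = 0"
    by metis
  ultimately obtain \<mu>0 where "floquet_cubic f \<mu>0 s0 = 0" "deriv f (-s0) + deriv f s0 * \<mu>0 = 0"
    using off_axis_roots_accumulate_critical [OF \<open>Re s0 = 0\<close>] by metis
  then show ?thesis
    by (simp add: Phi3_eq_cubic)
qed

end

section \<open>The branch of a simple multiplier\<close>

lemma monic_cubic_factorization:
  fixes a b c :: complex
  obtains z1 z2 z3 where "\<And>x. x^3 + a * x\<^sup>2 + b * x + c = (x - z1) * (x - z2) * (x - z3)"
proof -
  define k where "k = (\<lambda>i::nat. if i = 0 then c else if i = 1 then b else if i = 2 then a else 1)"
  obtain z where "(\<Sum>i\<le>3. k i * z ^ i) = 0"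
  proof (rule fundamental_theorem_of_algebra)
    show "k 0 = 0 \<or> (\<exists>i\<in>{1..3}. k i \<noteq> 0)"
      by (intro disjI2 bexI [of _ 3]) (auto simp: k_def)
  qed
  then have "z^3 + a * z\<^sup>2 + b * z + c = 0"
    by (simp add: k_def eval_nat_numeral algebra_simps)
  then have c: "c = - (z^3 + a * z\<^sup>2 + b * z)"
    by algebra
  define p where "p = a + z"
  define q where "q = b + z * p"
  define w where "w = csqrt (p\<^sup>2 - 4 * q)"
  have w: "w\<^sup>2 = p\<^sup>2 - 4 * q"
    by (simp add: w_def)
  have "x^3 + a * x\<^sup>2 + b * x + c = (x - z) * (x - (- p + w) / 2) * (x - (- p - w) / 2)" for x
  proof -
    have "(x - z) * (x - (- p + w) / 2) * (x - (- p - w) / 2) = (x - z) * (((2 * x + p)\<^sup>2 - w\<^sup>2) / 4)"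
      by (simp add: field_simps power2_eq_square)
    also have "\<dots> = (x - z) * (x\<^sup>2 + p * x + q)"
      unfolding w by (simp add: field_simps power2_eq_square)
    also have "\<dots> = x^3 + a * x\<^sup>2 + b * x + c"
      unfolding c q_def p_def by algebra
    finally show ?thesis ..
  qed
  with that show thesis
    by blast
qed

text \<open>The divided difference of the cubic in \<open>\<mu>\<close>; on the diagonal \<open>\<mu> = \<nu>\<close> it is the partial derivative
  in \<open>\<mu>\<close>.\<close>
definition cubic_slope :: "(complex \<Rightarrow> complex) \<Rightarrow> complex \<Rightarrow> complex \<Rightarrow> complex \<Rightarrow> complex" where
  "cubic_slope f \<mu> \<nu> s = - f (-s) + f s * (\<mu> + \<nu>) - (\<mu>\<^sup>2 + \<mu> * \<nu> + \<nu>\<^sup>2)"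

lemma cubic_slope_diff:
  "floquet_cubic f \<mu> s - floquet_cubic f \<nu> s = (\<mu> - \<nu>) * cubic_slope f \<mu> \<nu> s"
  unfolding floquet_cubic_def cubic_slope_def by algebra

text \<open>The cubic at \<open>\<mu>0\<close> is, up to sign, the product of the distances from \<open>\<mu>0\<close> to the three roots, so one
  of them is less than the cube root of its modulus.\<close>
lemma cubic_root_near:
  assumes "norm (floquet_cubic f \<mu>0 s) < d ^ 3"
  obtains \<mu> where "dist \<mu> \<mu>0 < d" "floquet_cubic f \<mu> s = 0"
proof -
  obtain z1 z2 z3 where "\<And>x. x^3 + (- f s) * x\<^sup>2 + f (-s) * x + (- 1) = (x - z1) * (x - z2) * (x - z3)"
    using monic_cubic_factorization by blast
  moreover have "floquet_cubic f x s = - (x^3 + (- f s) * x\<^sup>2 + f (-s) * x + (- 1))" for x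
    by (simp add: floquet_cubic_def)
  ultimately have fact: "floquet_cubic f x s = - ((x - z1) * (x - z2) * (x - z3))" for x
    by metis
  have "dist z1 \<mu>0 < d \<or> dist z2 \<mu>0 < d \<or> dist z3 \<mu>0 < d"
  proof (rule ccontr)
    assume *: "\<not> ?thesis"
    show False
    proof (cases "d \<ge> 0")
      case True
      have "d * d * d \<le> norm (\<mu>0 - z1) * norm (\<mu>0 - z2) * norm (\<mu>0 - z3)"
        using * True by (intro mult_mono mult_nonneg_nonneg) (auto simp: dist_norm norm_minus_commute)
      then show False
        using assms by (simp add: fact norm_mult power3_eq_cube)
    next
      case False
      then have "d ^ 3 \<le> 0"
        by simp
      with assms show False
        by (smt (verit) norm_ge_zero)
    qed
  qed
  then show thesis
    using that fact by auto
qed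

context reflection_symmetric_entire
begin

lemma tendsto_cubic_slope:
  assumes "(m \<longlongrightarrow> \<mu>) F" "(n \<longlongrightarrow> \<nu>) F" "(x \<longlongrightarrow> s) F"
  shows "((\<lambda>t. cubic_slope f (m t) (n t) (x t)) \<longlongrightarrow> cubic_slope f \<mu> \<nu> s) F"
  unfolding cubic_slope_def by (intro tendsto_intros tendsto_compose_entire assms)

lemma cubic_slope_bounded_below:
  assumes "cubic_slope f \<mu>0 \<mu>0 s0 \<noteq> 0"
  obtains d where "d > 0"
    "\<And>\<mu> \<nu> s. \<lbrakk>dist \<mu> \<mu>0 < d; dist \<nu> \<mu>0 < d; dist s s0 < d\<rbrakk>
      \<Longrightarrow> norm (cubic_slope f \<mu>0 \<mu>0 s0) / 2 < norm (cubic_slope f \<mu> \<nu> s)"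
proof -
  define q where "q = (\<lambda>(\<mu>, \<nu>, s). cubic_slope f \<mu> \<nu> s)"
  have fst: "((\<lambda>z::complex \<times> complex \<times> complex. fst z) \<longlongrightarrow> \<mu>0) (nhds (\<mu>0, \<mu>0, s0))"
    and snd: "((\<lambda>z::complex \<times> complex \<times> complex. fst (snd z)) \<longlongrightarrow> \<mu>0) (nhds (\<mu>0, \<mu>0, s0))"
    and thd: "((\<lambda>z::complex \<times> complex \<times> complex. snd (snd z)) \<longlongrightarrow> s0) (nhds (\<mu>0, \<mu>0, s0))"
    by (auto intro!: tendsto_eq_intros filterlim_ident)
  have "(q \<longlongrightarrow> cubic_slope f \<mu>0 \<mu>0 s0) (nhds (\<mu>0, \<mu>0, s0))"
    using tendsto_cubic_slope [OF fst snd thd] by (simp add: q_def case_prod_unfold)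
  then have "\<forall>\<^sub>F z in nhds (\<mu>0, \<mu>0, s0). norm (cubic_slope f \<mu>0 \<mu>0 s0) / 2 < norm (q z)"
    using assms by (intro order_tendstoD(1) [OF tendsto_norm]) auto
  then obtain e where "e > 0"
    and e: "\<And>z. dist z (\<mu>0, \<mu>0, s0) < e \<Longrightarrow> norm (cubic_slope f \<mu>0 \<mu>0 s0) / 2 < norm (q z)"
    unfolding eventually_nhds_metric by blast
  show thesis
  proof (rule that [of "e / 3"])
    fix \<mu> \<nu> s assume less: "dist \<mu> \<mu>0 < e / 3" "dist \<nu> \<mu>0 < e / 3" "dist s s0 < e / 3"
    have "dist (\<mu>, \<nu>, s) (\<mu>0, \<mu>0, s0) \<le> dist \<mu> \<mu>0 + (dist \<nu> \<mu>0 + dist s s0)"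
      using norm_Pair_le [of "\<mu> - \<mu>0" "(\<nu> - \<mu>0, s - s0)"] norm_Pair_le [of "\<nu> - \<mu>0" "s - s0"]
      by (simp add: dist_norm)
    also have "\<dots> < e"
      using less by simp
    finally show "norm (cubic_slope f \<mu>0 \<mu>0 s0) / 2 < norm (cubic_slope f \<mu> \<nu> s)"
      using e [of "(\<mu>, \<nu>, s)"] by (simp add: q_def)
  qed (use \<open>e > 0\<close> in simp)
qed

text \<open>A holomorphic implicit function theorem for the cubic. A root of the cubic near \<open>\<mu>0\<close> exists
  by the product bound, and it is unique because the divided difference stays away from zero. The
  identity \<open>(m s - m t) slope = - (p (m t) s - p (m t) t)\<close> then gives first continuity and, after
  division by \<open>s - t\<close>, the derivative.\<close>
lemma simple_multiplier_branch:
  assumes root: "floquet_cubic f \<mu>0 s0 = 0" and simple: "cubic_slope f \<mu>0 \<mu>0 s0 \<noteq> 0"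
  obtains m r d where "r > 0" "d > 0" "m s0 = \<mu>0"
    "\<And>s \<mu>. \<lbrakk>s \<in> ball s0 r; \<mu> \<in> ball \<mu>0 d\<rbrakk> \<Longrightarrow> floquet_cubic f \<mu> s = 0 \<longleftrightarrow> \<mu> = m s"
    "\<And>s. s \<in> ball s0 r \<Longrightarrow> floquet_cubic f (m s) s = 0"
    "\<And>s. s \<in> ball s0 r \<Longrightarrow> cubic_slope f (m s) (m s) s \<noteq> 0"
    "\<And>s. s \<in> ball s0 r \<Longrightarrow> (m has_field_derivative
        - (deriv f (-s) * m s + deriv f s * (m s)\<^sup>2) / cubic_slope f (m s) (m s) s) (at s)"
proof -
  define D where "D = norm (cubic_slope f \<mu>0 \<mu>0 s0) / 2"
  have "D > 0"
    using simple by (simp add: D_def)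
  obtain d where "d > 0" and slope:
    "\<And>\<mu> \<nu> s. \<lbrakk>dist \<mu> \<mu>0 < d; dist \<nu> \<mu>0 < d; dist s s0 < d\<rbrakk> \<Longrightarrow> D < norm (cubic_slope f \<mu> \<nu> s)"
    unfolding D_def using cubic_slope_bounded_below [OF simple] by blast
  have "((\<lambda>s. norm (floquet_cubic f \<mu>0 s)) \<longlongrightarrow> norm (floquet_cubic f \<mu>0 s0)) (nhds s0)"
    using DERIV_isCont [OF DERIV_cubic]
    by (intro tendsto_norm) (simp add: isCont_def tendsto_at_iff_tendsto_nhds)
  then have "\<forall>\<^sub>F s in nhds s0. norm (floquet_cubic f \<mu>0 s) < d ^ 3"
    using root \<open>d > 0\<close> by (intro order_tendstoD(2)) auto
  then obtain r0 where "r0 > 0" and r0: "\<And>s. dist s s0 < r0 \<Longrightarrow> norm (floquet_cubic f \<mu>0 s) < d ^ 3"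
    unfolding eventually_nhds_metric by blast
  define r where "r = min r0 d"
  define m where "m = (\<lambda>s. SOME \<mu>. dist \<mu> \<mu>0 < d \<and> floquet_cubic f \<mu> s = 0)"
  have "r > 0"
    using \<open>r0 > 0\<close> \<open>d > 0\<close> by (simp add: r_def)
  have m: "dist (m s) \<mu>0 < d" "floquet_cubic f (m s) s = 0" if "s \<in> ball s0 r" for s
  proof -
    have "\<exists>\<mu>. dist \<mu> \<mu>0 < d \<and> floquet_cubic f \<mu> s = 0"
      using cubic_root_near [OF r0] that by (metis dist_commute mem_ball min_less_iff_conj r_def)
    then have "dist (m s) \<mu>0 < d \<and> floquet_cubic f (m s) s = 0"
      unfolding m_def by (rule someI_ex)
    then show "dist (m s) \<mu>0 < d" "floquet_cubic f (m s) s = 0"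
      by auto
  qed
  have slope_m: "D < norm (cubic_slope f \<mu> (m t) s)" if "s \<in> ball s0 r" "t \<in> ball s0 r" "\<mu> \<in> ball \<mu>0 d" for \<mu> s t
    using that m(1) [OF that(2)] by (intro slope) (auto simp: r_def dist_commute)
  have unique: "floquet_cubic f \<mu> s = 0 \<longleftrightarrow> \<mu> = m s" if "s \<in> ball s0 r" "\<mu> \<in> ball \<mu>0 d" for s \<mu>
    using cubic_slope_diff [of f \<mu> s "m s"] m(2) [OF that(1)] slope_m [OF that(1) that(1) that(2)] \<open>D > 0\<close>
    by auto
  have increment: "m s - m t = - (floquet_cubic f (m t) s - floquet_cubic f (m t) t) / cubic_slope f (m s) (m t) s"
    and slope_ms: "D < norm (cubic_slope f (m s) (m t) s)"
    if "s \<in> ball s0 r" "t \<in> ball s0 r" for s t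
  proof -
    show *: "D < norm (cubic_slope f (m s) (m t) s)"
      using slope_m [OF that, of "m s"] m(1) [OF that(1)] by (simp add: dist_commute)
    show "m s - m t = - (floquet_cubic f (m t) s - floquet_cubic f (m t) t) / cubic_slope f (m s) (m t) s"
      using cubic_slope_diff [of f "m s" s "m t"] m(2) that * \<open>D > 0\<close>
      by (subst eq_divide_eq) auto
  qed
  have near: "\<forall>\<^sub>F s in at t. s \<in> ball s0 r" if "t \<in> ball s0 r" for t
    using that by (intro eventually_at_in_open') auto
  have cont: "(m \<longlongrightarrow> m t) (at t)" if t: "t \<in> ball s0 r" for t
  proof -
    have "((\<lambda>s. norm (floquet_cubic f (m t) s - floquet_cubic f (m t) t) / D) \<longlongrightarrow>
        norm (floquet_cubic f (m t) t - floquet_cubic f (m t) t) / D) (at t)"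
      using DERIV_isCont [OF DERIV_cubic] \<open>D > 0\<close> by (intro tendsto_intros) (auto simp: isCont_def)
    then have "((\<lambda>s. norm (floquet_cubic f (m t) s - floquet_cubic f (m t) t) / D) \<longlongrightarrow> 0) (at t)"
      by simp
    moreover have "\<forall>\<^sub>F s in at t. norm (m s - m t) \<le> norm (floquet_cubic f (m t) s - floquet_cubic f (m t) t) / D"
      using near [OF t]
    proof eventually_elim
      case (elim s)
      show ?case
        unfolding increment [OF elim t] norm_divide norm_minus_cancel
        using slope_ms [OF elim t] \<open>D > 0\<close> by (intro divide_left_mono mult_pos_pos) auto
    qed
    ultimately have "((\<lambda>s. m s - m t) \<longlongrightarrow> 0) (at t)"
      by (rule Lim_null_comparison [rotated])
    then show ?thesis
      by (simp add: LIM_zero_iff)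
  qed
  have der: "(m has_field_derivative
        - (deriv f (-t) * m t + deriv f t * (m t)\<^sup>2) / cubic_slope f (m t) (m t) t) (at t)"
    if t: "t \<in> ball s0 r" for t
    unfolding has_field_derivative_iff
  proof (rule Lim_transform_eventually)
    have "((\<lambda>s. (floquet_cubic f (m t) s - floquet_cubic f (m t) t) / (s - t)) \<longlongrightarrow>
        deriv f (-t) * m t + deriv f t * (m t)\<^sup>2) (at t)"
      using DERIV_cubic [of "m t" t] by (simp add: has_field_derivative_iff)
    moreover have "((\<lambda>s. cubic_slope f (m s) (m t) s) \<longlongrightarrow> cubic_slope f (m t) (m t) t) (at t)"
      by (intro tendsto_cubic_slope cont t tendsto_const tendsto_ident_at)
    moreover have "cubic_slope f (m t) (m t) t \<noteq> 0"
      using slope_ms [OF t t] \<open>D > 0\<close> by auto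
    ultimately show "((\<lambda>s. - ((floquet_cubic f (m t) s - floquet_cubic f (m t) t) / (s - t)) / cubic_slope f (m s) (m t) s)
        \<longlongrightarrow> - (deriv f (-t) * m t + deriv f t * (m t)\<^sup>2) / cubic_slope f (m t) (m t) t) (at t)"
      by (intro tendsto_intros)
    show "\<forall>\<^sub>F s in at t. - ((floquet_cubic f (m t) s - floquet_cubic f (m t) t) / (s - t)) / cubic_slope f (m s) (m t) s
        = (m s - m t) / (s - t)"
      using near [OF t]
    proof eventually_elim
      case (elim s)
      have "- (a / b) / q = - a / q / b" for a b q :: complex
        by (simp add: mult.commute)
      then show ?case
        by (simp only: increment [OF elim t])
    qed
  qed
  have "m s0 = \<mu>0"
    using unique [of s0 \<mu>0] root \<open>r > 0\<close> \<open>d > 0\<close> by simp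
  moreover have "cubic_slope f (m s) (m s) s \<noteq> 0" if "s \<in> ball s0 r" for s
    using slope_ms [OF that that] \<open>D > 0\<close> by auto
  ultimately show thesis
    using that [of r d m] \<open>r > 0\<close> \<open>d > 0\<close> unique m(2) der by blast
qed

end


section \<open>Square-root coordinates at a double point\<close>

text \<open>Since \<open>m - m s0\<close> vanishes to order exactly two at \<open>s0\<close>, it is the square of a function \<open>\<phi>\<close> with
  \<open>\<phi>'(s0) \<noteq> 0\<close>, and \<open>\<psi>\<close> is the local inverse of \<open>\<phi>\<close>. The last property makes sure that
  \<open>\<psi>\<close> reaches all points near \<open>s0\<close>, so that no root is overlooked.\<close>
lemma double_point_square_root_coordinate:
  fixes m :: "complex \<Rightarrow> complex"
  assumes hol: "m holomorphic_on ball s0 r" and "r > 0"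
    and d1: "deriv m s0 = 0" and d2: "deriv (deriv m) s0 \<noteq> 0"
  obtains \<psi> R \<rho> where "R > 0" "\<rho> > 0" "\<psi> holomorphic_on ball 0 R" "\<psi> 0 = s0"
    "deriv (deriv m) s0 * (deriv \<psi> 0)\<^sup>2 = 2"
    "\<And>w. w \<in> ball 0 R \<Longrightarrow> \<psi> w \<in> ball s0 r \<and> m (\<psi> w) = m s0 + w\<^sup>2"
    "ball s0 \<rho> \<subseteq> \<psi> ` ball 0 R"
proof -
  have "(deriv ^^ 2) m s0 \<noteq> 0"
    using d2 by (simp add: eval_nat_numeral)
  moreover have "(deriv ^^ i) m s0 = 0" if "0 < i" "i < 2" for i
    using that d1 by (cases "i = 1") auto
  moreover have "s0 \<in> ball s0 r" "0 < (2::nat)"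
    using \<open>r > 0\<close> by auto
  ultimately obtain g r1 where "r1 > 0" and g: "g holomorphic_on ball s0 r1"
    and gm: "\<And>w. w \<in> ball s0 r1 \<Longrightarrow> m w - m s0 = ((w - s0) * g w)\<^sup>2"
    and g0: "\<And>w. w \<in> ball s0 r1 \<Longrightarrow> g w \<noteq> 0"
    using holomorphic_factor_order_of_zero_strong [OF hol open_ball] by metis
  define B where "B = ball s0 (min r r1)"
  define \<phi> where "\<phi> = (\<lambda>w. (w - s0) * g w)"
  have "s0 \<in> B" "open B" "B \<subseteq> ball s0 r" "B \<subseteq> ball s0 r1"
    using \<open>r > 0\<close> \<open>r1 > 0\<close> by (auto simp: B_def)
  have \<phi>: "\<phi> holomorphic_on B"
    unfolding \<phi>_def using \<open>B \<subseteq> ball s0 r1\<close> g by (intro holomorphic_intros) (auto intro: holomorphic_on_subset)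
  have m\<phi>: "m s = m s0 + (\<phi> s)\<^sup>2" if "s \<in> B" for s
    using gm [of s] that \<open>B \<subseteq> ball s0 r1\<close> by (auto simp: \<phi>_def algebra_simps)
  have "(\<phi> has_field_derivative g s0) (at s0)"
    unfolding \<phi>_def using holomorphic_derivI [OF g open_ball, of s0] \<open>r1 > 0\<close>
    by (auto intro!: derivative_eq_intros)
  then have d\<phi>: "deriv \<phi> s0 = g s0"
    by (rule DERIV_imp_deriv)
  then have d\<phi>0: "deriv \<phi> s0 \<noteq> 0"
    using g0 [of s0] \<open>r1 > 0\<close> by simp
  have \<phi>0: "\<phi> s0 = 0"
    by (simp add: \<phi>_def)
  have second: "deriv (deriv m) s0 = 2 * (deriv \<phi> s0)\<^sup>2"
  proof -
    have "deriv m s = 2 * \<phi> s * deriv \<phi> s" if "s \<in> B" for s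
    proof (rule DERIV_imp_deriv)
      have "((\<lambda>s. m s0 + (\<phi> s)\<^sup>2) has_field_derivative 2 * \<phi> s * deriv \<phi> s) (at s)"
        using holomorphic_derivI [OF \<phi> \<open>open B\<close> that] by (auto intro!: derivative_eq_intros)
      then show "(m has_field_derivative 2 * \<phi> s * deriv \<phi> s) (at s)"
        using m\<phi> that \<open>open B\<close> by (auto elim: has_field_derivative_transform_within_open)
    qed
    moreover have "((\<lambda>s. 2 * \<phi> s * deriv \<phi> s) has_field_derivative 2 * (deriv \<phi> s0)\<^sup>2) (at s0)"
      using holomorphic_derivI [OF \<phi> \<open>open B\<close> \<open>s0 \<in> B\<close>]
        holomorphic_derivI [OF holomorphic_deriv [OF \<phi> \<open>open B\<close>] \<open>open B\<close> \<open>s0 \<in> B\<close>]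
      by (auto intro!: derivative_eq_intros simp: \<phi>0 power2_eq_square)
    ultimately have "(deriv m has_field_derivative 2 * (deriv \<phi> s0)\<^sup>2) (at s0)"
      using \<open>s0 \<in> B\<close> \<open>open B\<close> by (metis (no_types, lifting) has_field_derivative_transform_within_open)
    then show ?thesis
      by (rule DERIV_imp_deriv)
  qed
  obtain r2 where "r2 > 0" "ball s0 r2 \<subseteq> B" "open (\<phi> ` ball s0 r2)" "inj_on \<phi> (ball s0 r2)"
    using has_complex_derivative_locally_invertible [OF \<phi> \<open>s0 \<in> B\<close> \<open>open B\<close> d\<phi>0] by blast
  obtain \<psi> where \<psi>: "\<psi> holomorphic_on \<phi> ` ball s0 r2"
    and \<psi>d: "\<And>z. z \<in> ball s0 r2 \<Longrightarrow> deriv \<phi> z * deriv \<psi> (\<phi> z) = 1"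
    and \<psi>\<phi>: "\<And>z. z \<in> ball s0 r2 \<Longrightarrow> \<psi> (\<phi> z) = z"
    using holomorphic_has_inverse [OF holomorphic_on_subset [OF \<phi> \<open>ball s0 r2 \<subseteq> B\<close>] open_ball
        \<open>inj_on \<phi> (ball s0 r2)\<close>] by blast
  have "0 \<in> \<phi> ` ball s0 r2"
    using \<phi>0 \<open>r2 > 0\<close> by (metis centre_in_ball imageI)
  then obtain R where "R > 0" and R: "ball 0 R \<subseteq> \<phi> ` ball s0 r2"
    using \<open>open (\<phi> ` ball s0 r2)\<close> open_contains_ball by blast
  have "continuous (at s0) \<phi>"
    using \<open>(\<phi> has_field_derivative g s0) (at s0)\<close> by (rule DERIV_isCont)
  then obtain r3 where "r3 > 0" and r3: "\<And>s. dist s s0 < r3 \<Longrightarrow> dist (\<phi> s) 0 < R"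
    using \<open>R > 0\<close> unfolding continuous_at_eps_delta dist_norm \<phi>0 by metis
  define \<rho> where "\<rho> = min r2 r3"
  show thesis
  proof (rule that [OF \<open>R > 0\<close>, of \<rho> \<psi>])
    show "\<rho> > 0"
      using \<open>r2 > 0\<close> \<open>r3 > 0\<close> by (simp add: \<rho>_def)
    show "\<psi> holomorphic_on ball 0 R"
      by (rule holomorphic_on_subset [OF \<psi> R])
    show "\<psi> 0 = s0"
      using \<psi>\<phi> [of s0] \<open>r2 > 0\<close> by (simp add: \<phi>0)
    show "deriv (deriv m) s0 * (deriv \<psi> 0)\<^sup>2 = 2"
    proof -
      have "deriv \<phi> s0 * deriv \<psi> 0 = 1"
        using \<psi>d [of s0] \<open>r2 > 0\<close> by (simp add: \<phi>0)
      then have "(deriv \<phi> s0)\<^sup>2 * (deriv \<psi> 0)\<^sup>2 = 1"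
        by (metis power_mult_distrib one_power2)
      then show ?thesis
        by (simp add: second)
    qed
    show "\<psi> w \<in> ball s0 r \<and> m (\<psi> w) = m s0 + w\<^sup>2" if w: "w \<in> ball 0 R" for w
    proof -
      obtain z where z: "z \<in> ball s0 r2" "w = \<phi> z"
        using subsetD [OF R w] by blast
      then have "z \<in> B"
        using \<open>ball s0 r2 \<subseteq> B\<close> by blast
      with z show ?thesis
        using \<psi>\<phi> m\<phi> \<open>B \<subseteq> ball s0 r\<close> by auto
    qed
    show "ball s0 \<rho> \<subseteq> \<psi> ` ball 0 R"
    proof
      fix s assume "s \<in> ball s0 \<rho>"
      then have "s \<in> ball s0 r2" "\<phi> s \<in> ball 0 R"
        using r3 [of s] by (auto simp: \<rho>_def dist_commute)
      then show "s \<in> \<psi> ` ball 0 R"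
        using \<psi>\<phi> by (metis imageI)
    qed
  qed
qed

text \<open>To stay on the unit circle with a continuous square root of \<open>\<mu> - \<mu>0\<close>, let \<open>\<mu>\<close> run through the Cayley
  parametrization \<open>\<mu>0 (1 + \<i> \<epsilon> u\<^sup>2) / (1 - \<i> \<epsilon> u\<^sup>2)\<close>. Then
  \<open>\<mu> - \<mu>0 = 2 \<i> \<epsilon> \<mu>0 u\<^sup>2 / (1 - \<i> \<epsilon> u\<^sup>2)\<close>, whose square root \<open>c u / csqrt (1 - \<i> \<epsilon> u\<^sup>2)\<close> avoids the
  branch cut, because the radicand in the denominator has real part one.\<close>
lemma square_root_curve:
  fixes \<psi> :: "complex \<Rightarrow> complex" and \<epsilon> :: real
  assumes hol: "\<psi> holomorphic_on ball 0 R" and "R > 0"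
    and c: "c\<^sup>2 = 2 * \<i> * of_real \<epsilon> * \<mu>0" and "norm \<mu>0 = 1"
    and transversal: "Re (deriv \<psi> 0 * c) \<noteq> 0"
  obtains \<gamma> :: "real \<Rightarrow> complex" and \<delta> :: real where "\<delta> > 0"
    "continuous_on {0..\<delta>} \<gamma>" "\<gamma> 0 = \<psi> 0"
    "\<And>u. u \<in> {0..\<delta>} \<Longrightarrow> \<exists>w\<in>ball 0 R. \<gamma> u = \<psi> w \<and> norm (\<mu>0 + w\<^sup>2) = 1"
    "\<And>u. u \<in> {0<..\<delta>} \<Longrightarrow> Re (\<gamma> u - \<psi> 0) \<noteq> 0"
    "((\<lambda>u. (\<gamma> u - \<psi> 0) / of_real u) \<longlongrightarrow> deriv \<psi> 0 * c) (at_right 0)"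
proof -
  define k where "k = (\<lambda>u::real. 1 - \<i> * of_real (\<epsilon> * u\<^sup>2))"
  define \<sigma> where "\<sigma> = (\<lambda>u. c * of_real u / csqrt (k u))"
  have k: "k u \<notin> \<real>\<^sub>\<le>\<^sub>0" for u
    by (simp add: k_def complex_nonpos_Reals_iff)
  then have k0: "k u \<noteq> 0" for u
    by (metis nonpos_Reals_zero_I)
  have "continuous_on UNIV k"
    unfolding k_def by (intro continuous_intros)
  then have contk: "continuous_on UNIV (\<lambda>u. csqrt (k u))"
    using k by (intro continuous_on_compose2 [OF continuous_on_csqrt]) auto
  have cont: "continuous_on UNIV \<sigma>"
    unfolding \<sigma>_def using k0 by (intro continuous_intros contk) auto
  have unit: "norm (\<mu>0 + (\<sigma> u)\<^sup>2) = 1" for u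
  proof -
    have "\<mu>0 + (\<sigma> u)\<^sup>2 = \<mu>0 * (1 + \<i> * of_real (\<epsilon> * u\<^sup>2)) / k u"
      using k0 [of u] by (simp add: \<sigma>_def power_divide power_mult_distrib c k_def field_simps)
    moreover have "norm (1 + \<i> * of_real (\<epsilon> * u\<^sup>2)) = norm (k u)"
      by (simp add: k_def cmod_def)
    ultimately show ?thesis
      using \<open>norm \<mu>0 = 1\<close> k0 [of u] by (simp add: norm_mult norm_divide)
  qed
  have "c \<noteq> 0"
    using transversal by auto
  have \<sigma>0: "\<sigma> u = 0 \<longleftrightarrow> u = 0" for u
    using k0 \<open>c \<noteq> 0\<close> by (auto simp: \<sigma>_def)
  have "(\<sigma> \<longlongrightarrow> \<sigma> 0) (at_right 0)"
    by (rule tendsto_within_subset [OF _ subset_UNIV]) (use cont in \<open>simp add: continuous_on_def\<close>)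
  then have \<sigma>right: "(\<sigma> \<longlongrightarrow> 0) (at_right 0)"
    using \<sigma>0 [of 0] by simp
  then have \<sigma>lim: "filterlim \<sigma> (at 0) (at_right 0)"
    by (rule filterlim_atI) (auto simp: \<sigma>0 eventually_at_filter)
  have "((\<lambda>u. csqrt (k u)) \<longlongrightarrow> csqrt (k 0)) (at_right 0)"
    by (rule tendsto_within_subset [OF _ subset_UNIV]) (use contk in \<open>simp add: continuous_on_def\<close>)
  then have "((\<lambda>u. c / csqrt (k u)) \<longlongrightarrow> c / csqrt (k 0)) (at_right 0)"
    by (rule tendsto_divide [OF tendsto_const]) (simp add: k_def)
  then have "((\<lambda>u. c / csqrt (k u)) \<longlongrightarrow> c) (at_right 0)"
    by (simp add: k_def)
  moreover have "\<forall>\<^sub>F u in at_right 0. c / csqrt (k u) = \<sigma> u / of_real u"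
    by (auto simp: \<sigma>_def eventually_at_filter)
  ultimately have \<sigma>rate: "((\<lambda>u. \<sigma> u / of_real u) \<longlongrightarrow> c) (at_right 0)"
    by (rule Lim_transform_eventually)
  have "(\<psi> has_field_derivative deriv \<psi> 0) (at 0)"
    using holomorphic_derivI [OF hol open_ball, of 0] \<open>R > 0\<close> by auto
  then have "((\<lambda>w. (\<psi> w - \<psi> 0) / w) \<longlongrightarrow> deriv \<psi> 0) (at 0)"
    by (simp add: has_field_derivative_iff)
  then have "((\<lambda>u. (\<psi> (\<sigma> u) - \<psi> 0) / \<sigma> u) \<longlongrightarrow> deriv \<psi> 0) (at_right 0)"
    by (rule filterlim_compose [OF _ \<sigma>lim])
  then have "((\<lambda>u. (\<psi> (\<sigma> u) - \<psi> 0) / \<sigma> u * (\<sigma> u / of_real u)) \<longlongrightarrow> deriv \<psi> 0 * c) (at_right 0)"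
    by (intro tendsto_mult \<sigma>rate)
  then have rate: "((\<lambda>u. (\<psi> (\<sigma> u) - \<psi> 0) / of_real u) \<longlongrightarrow> deriv \<psi> 0 * c) (at_right 0)"
    by (rule Lim_transform_eventually) (auto simp: eventually_at_filter \<sigma>0)
  have "\<forall>\<^sub>F u in at_right 0. (\<psi> (\<sigma> u) - \<psi> 0) / of_real u \<in> {z. Re z \<noteq> 0}"
    using transversal
    by (intro topological_tendstoD [OF rate] open_Collect_neq continuous_intros) auto
  moreover have "\<forall>\<^sub>F u in at_right (0::real). \<sigma> u \<in> ball 0 R"
    using \<open>R > 0\<close> by (intro topological_tendstoD [OF \<sigma>right]) auto
  ultimately have "\<forall>\<^sub>F u in at_right 0. Re ((\<psi> (\<sigma> u) - \<psi> 0) / of_real u) \<noteq> 0 \<and> \<sigma> u \<in> ball 0 R"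
    by eventually_elim auto
  then obtain b where "b > 0" and b: "\<And>u. \<lbrakk>0 < u; u < b\<rbrakk> \<Longrightarrow> Re ((\<psi> (\<sigma> u) - \<psi> 0) / of_real u) \<noteq> 0 \<and> \<sigma> u \<in> ball 0 R"
    unfolding eventually_at_right_field by (metis (no_types, lifting))
  define \<delta> where "\<delta> = b / 2"
  have "\<delta> > 0"
    using \<open>b > 0\<close> by (simp add: \<delta>_def)
  have inR: "\<sigma> u \<in> ball 0 R" if "u \<in> {0..\<delta>}" for u
  proof (cases "u = 0")
    case True
    then show ?thesis
      using \<sigma>0 [of 0] \<open>R > 0\<close> by simp
  next
    case False
    then show ?thesis
      using that b [of u] \<open>b > 0\<close> by (auto simp: \<delta>_def)
  qed
  show thesis
  proof (rule that [OF \<open>\<delta> > 0\<close>, of "\<psi> \<circ> \<sigma>"])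
    show "continuous_on {0..\<delta>} (\<psi> \<circ> \<sigma>)"
    proof (rule continuous_on_compose)
      show "continuous_on {0..\<delta>} \<sigma>"
        by (rule continuous_on_subset [OF cont]) simp
      show "continuous_on (\<sigma> ` {0..\<delta>}) \<psi>"
        by (rule continuous_on_subset [OF holomorphic_on_imp_continuous_on [OF hol]]) (use inR in auto)
    qed
    show "Re ((\<psi> \<circ> \<sigma>) u - \<psi> 0) \<noteq> 0" if "u \<in> {0<..\<delta>}" for u
      using b [of u] that \<open>b > 0\<close> by (auto simp: \<delta>_def)
    show "(\<psi> \<circ> \<sigma>) 0 = \<psi> 0"
      by (simp add: \<sigma>_def)
  qed (use inR unit rate in \<open>auto simp: o_def\<close>)
qed

lemma square_root_curve_bifurcates:
  fixes \<psi> :: "complex \<Rightarrow> complex"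
  assumes hol: "\<psi> holomorphic_on ball 0 R" and "R > 0"
    and c: "c\<^sup>2 = 2 * \<i> * of_real \<epsilon> * \<mu>0" and "norm \<mu>0 = 1"
    and transversal: "Re (deriv \<psi> 0 * c) \<noteq> 0"
    and "\<psi> 0 \<in> imaginary_axis" "imaginary_axis \<subseteq> S"
    and spec: "\<And>w. \<lbrakk>w \<in> ball 0 R; norm (\<mu>0 + w\<^sup>2) = 1\<rbrakk> \<Longrightarrow> \<psi> w \<in> S"
  shows "bifurcates_off_axis S (\<psi> 0)"
proof -
  obtain \<gamma> :: "real \<Rightarrow> complex" and \<delta> :: real where "\<delta> > 0"
    and cont: "continuous_on {0..\<delta>} \<gamma>" and \<gamma>0: "\<gamma> 0 = \<psi> 0"
    and img: "\<And>u. u \<in> {0..\<delta>} \<Longrightarrow> \<exists>w\<in>ball 0 R. \<gamma> u = \<psi> w \<and> norm (\<mu>0 + w\<^sup>2) = 1"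
    and off: "\<And>u. u \<in> {0<..\<delta>} \<Longrightarrow> Re (\<gamma> u - \<psi> 0) \<noteq> 0"
    and rate: "((\<lambda>u. (\<gamma> u - \<psi> 0) / of_real u) \<longlongrightarrow> deriv \<psi> 0 * c) (at_right 0)"
    by (rule square_root_curve [OF assms(1-5)]) (rule that; assumption)
  define g where "g = (\<lambda>t. \<gamma> (\<delta> * t))"
  have range: "\<delta> * t \<in> {0..\<delta>}" if "t \<in> {0..1}" for t
    using that \<open>\<delta> > 0\<close> by (auto simp: mult_le_cancel_left1)
  have "path g"
    unfolding path_def g_def
    by (rule continuous_on_compose2 [OF cont]) (use range in \<open>auto intro!: continuous_intros\<close>)
  moreover have "pathstart g = \<psi> 0"
    by (simp add: pathstart_def g_def \<gamma>0)
  moreover have "path_image g \<subseteq> S"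
    unfolding path_image_def g_def using img [OF range] spec by fastforce
  moreover have "g t \<notin> imaginary_axis" if "t \<in> {0<..1}" for t
    using off [of "\<delta> * t"] range [of t] that \<open>\<delta> > 0\<close> \<open>\<psi> 0 \<in> imaginary_axis\<close>
    by (auto simp: g_def imaginary_axis_def)
  moreover have "((\<lambda>t. sgn (g t - \<psi> 0)) \<longlongrightarrow> sgn (deriv \<psi> 0 * c)) (at_right 0)"
  proof -
    have "deriv \<psi> 0 * c \<noteq> 0"
      using transversal by auto
    then have "((\<lambda>u. sgn ((\<gamma> u - \<psi> 0) / of_real u)) \<longlongrightarrow> sgn (deriv \<psi> 0 * c)) (at_right 0)"
      by (rule tendsto_sgn [OF rate])
    moreover have "filterlim (\<lambda>t. \<delta> * t) (at_right 0) (at_right 0)"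
      unfolding filterlim_at using \<open>\<delta> > 0\<close>
      by (auto simp: eventually_at_filter intro!: tendsto_eq_intros)
    ultimately have "((\<lambda>t. sgn ((\<gamma> (\<delta> * t) - \<psi> 0) / of_real (\<delta> * t))) \<longlongrightarrow> sgn (deriv \<psi> 0 * c)) (at_right 0)"
      by (rule filterlim_compose)
    moreover have "sgn ((\<gamma> (\<delta> * t) - \<psi> 0) / of_real (\<delta> * t)) = sgn (g t - \<psi> 0)" if "t > 0" for t
    proof -
      have "sgn (z / of_real r) = sgn z" if "r > 0" for z :: complex and r :: real
        using that by (simp add: sgn_div_norm norm_divide scaleR_conv_of_real divide_simps)
      then show ?thesis
        using that \<open>\<delta> > 0\<close> unfolding g_def by (metis mult_pos_pos)
    qed
    then have "\<forall>\<^sub>F t in at_right 0. sgn ((\<gamma> (\<delta> * t) - \<psi> 0) / of_real (\<delta> * t)) = sgn (g t - \<psi> 0)"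
      unfolding eventually_at_right_field by (metis zero_less_one)
    ultimately show ?thesis
      by (rule Lim_transform_eventually)
  qed
  moreover have "sgn (deriv \<psi> 0 * c) \<notin> imaginary_axis"
  proof -
    have "deriv \<psi> 0 * c \<noteq> 0"
      using transversal by auto
    then show ?thesis
      using transversal by (simp add: imaginary_axis_def sgn_div_norm scaleR_conv_of_real [symmetric] del: times_complex.simps)
  qed
  moreover have "\<exists>a b. a \<in> imaginary_axis \<and> b \<in> imaginary_axis \<and> a \<noteq> b \<and> \<psi> 0 \<in> closed_segment a b \<and> closed_segment a b \<subseteq> S"
  proof -
    have "convex imaginary_axis"
      unfolding imaginary_axis_def by (rule convexI) auto
    moreover have "\<psi> 0 + \<i> \<in> imaginary_axis"
      using \<open>\<psi> 0 \<in> imaginary_axis\<close> by (auto simp: imaginary_axis_def)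
    moreover have "closed_segment (\<psi> 0) (\<psi> 0 + \<i>) \<subseteq> S"
      using calculation \<open>\<psi> 0 \<in> imaginary_axis\<close> \<open>imaginary_axis \<subseteq> S\<close>
      by (meson closed_segment_subset order_trans)
    ultimately show ?thesis
      using \<open>\<psi> 0 \<in> imaginary_axis\<close>
      by (intro exI [of _ "\<psi> 0"] exI [of _ "\<psi> 0 + \<i>"]) simp
  qed
  ultimately show ?thesis
    unfolding bifurcates_off_axis_def by blast
qed

lemma filterlim_csqrt_shift: "filterlim (\<lambda>\<mu>. csqrt (\<mu> - \<mu>0)) (at 0) (at \<mu>0 within S)"
proof (rule filterlim_atI)
  have "((\<lambda>\<mu>. sqrt (norm (\<mu> - \<mu>0))) \<longlongrightarrow> sqrt (norm (\<mu>0 - \<mu>0))) (at \<mu>0 within S)"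
    by (intro tendsto_intros)
  moreover have "norm (csqrt z) = sqrt (norm z)" for z
    by (metis norm_ge_zero norm_power power2_csqrt real_sqrt_unique)
  ultimately show "((\<lambda>\<mu>. csqrt (\<mu> - \<mu>0)) \<longlongrightarrow> 0) (at \<mu>0 within S)"
    by (subst tendsto_norm_zero_iff [symmetric]) simp
  show "\<forall>\<^sub>F \<mu> in at \<mu>0 within S. csqrt (\<mu> - \<mu>0) \<noteq> 0"
    by (auto simp: eventually_at_filter)
qed

text \<open>For \<open>\<mu>\<close> near \<open>\<mu>0\<close> the equation \<open>\<mu> = \<mu>0 + w\<^sup>2\<close> has the two solutions \<open>w = \<plusminus> csqrt (\<mu> - \<mu>0)\<close>, and the
  expansion of \<open>\<psi>\<close> at \<open>0\<close> to first order is composed with them.\<close>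
lemma sqrt_normal_form_of_coordinate:
  fixes p :: "complex \<Rightarrow> complex \<Rightarrow> complex"
  assumes hol: "\<psi> holomorphic_on ball 0 R" and "R > 0" and \<psi>0: "\<psi> 0 = s0"
    and "\<rho> > 0" "d > 0" and cover: "ball s0 \<rho> \<subseteq> \<psi> ` ball 0 R"
    and roots: "\<And>w \<mu>. \<lbrakk>w \<in> ball 0 R; \<mu> \<in> ball \<mu>0 d\<rbrakk> \<Longrightarrow> p \<mu> (\<psi> w) = 0 \<longleftrightarrow> \<mu> = \<mu>0 + w\<^sup>2"
  shows "sqrt_normal_form p \<mu>0 s0 (deriv \<psi> 0)"
proof -
  define q where "q = (\<lambda>\<mu>. csqrt (\<mu> - \<mu>0))"
  have q2: "(q \<mu>)\<^sup>2 = \<mu> - \<mu>0" for \<mu>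
    by (simp add: q_def)
  have der: "(\<psi> has_field_derivative deriv \<psi> 0) (at 0)"
    using holomorphic_derivI [OF hol open_ball, of 0] \<open>R > 0\<close> by auto
  then obtain \<eta> where "\<eta> > 0" and \<eta>: "\<And>w. norm w < \<eta> \<Longrightarrow> \<psi> w \<in> ball s0 \<rho>"
    using \<open>\<rho> > 0\<close> DERIV_isCont [OF der] unfolding continuous_at_eps_delta \<psi>0
    by (metis dist_commute dist_norm diff_zero mem_ball)
  define e where "e = min d ((min \<eta> R)\<^sup>2)"
  have "e > 0"
    using \<open>d > 0\<close> \<open>\<eta> > 0\<close> \<open>R > 0\<close> by (simp add: e_def)
  have small: "norm (q \<mu>) < min \<eta> R" if "norm (\<mu> - \<mu>0) < e" for \<mu>
  proof -
    have "(norm (q \<mu>))\<^sup>2 < (min \<eta> R)\<^sup>2"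
      using that by (simp add: q2 norm_power [symmetric] e_def)
    then show ?thesis
      by (rule power2_less_imp_less) (use \<open>\<eta> > 0\<close> \<open>R > 0\<close> in auto)
  qed
  have set_eq: "{s. norm (s - s0) < \<rho> \<and> p \<mu> s = 0} = {\<psi> (q \<mu>), \<psi> (- q \<mu>)}" if "norm (\<mu> - \<mu>0) < e" for \<mu>
  proof (intro equalityI subsetI)
    have \<mu>: "\<mu> \<in> ball \<mu>0 d"
      using that by (simp add: e_def dist_norm norm_minus_commute)
    fix s
    show "s \<in> {\<psi> (q \<mu>), \<psi> (- q \<mu>)}" if s: "s \<in> {s. norm (s - s0) < \<rho> \<and> p \<mu> s = 0}"
    proof -
      have "s \<in> ball s0 \<rho>"
        using s by (simp add: dist_norm norm_minus_commute)
      then obtain w where "w \<in> ball 0 R" "s = \<psi> w"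
        using cover by blast
      then have "w\<^sup>2 = (q \<mu>)\<^sup>2"
        using roots [of w \<mu>] s \<mu> by (auto simp: q2)
      with \<open>s = \<psi> w\<close> show ?thesis
        by (auto simp: power2_eq_iff)
    qed
    show "s \<in> {s. norm (s - s0) < \<rho> \<and> p \<mu> s = 0}" if s: "s \<in> {\<psi> (q \<mu>), \<psi> (- q \<mu>)}"
    proof -
      obtain w where w: "s = \<psi> w" "w\<^sup>2 = (q \<mu>)\<^sup>2" "norm w = norm (q \<mu>)"
        using s by (metis insertE norm_minus_cancel power2_minus singletonD)
      then have "w \<in> ball 0 R" "\<psi> w \<in> ball s0 \<rho>"
        using small [OF \<open>norm (\<mu> - \<mu>0) < e\<close>] \<eta> [of w] by auto
      then show ?thesis
        using roots [of w \<mu>] \<mu> w by (auto simp: q2 dist_norm norm_minus_commute)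
    qed
  qed
  have "((\<lambda>w. (\<psi> w - s0) / w - deriv \<psi> 0) \<longlongrightarrow> deriv \<psi> 0 - deriv \<psi> 0) (at 0)"
    using der by (intro tendsto_intros) (simp add: has_field_derivative_iff \<psi>0)
  then have "((\<lambda>w. (\<psi> w - s0) / w - deriv \<psi> 0) \<longlongrightarrow> 0) (at 0)"
    by simp
  moreover have "\<forall>\<^sub>F w in at 0. (\<psi> w - s0) / w - deriv \<psi> 0 = (\<psi> w - s0 - deriv \<psi> 0 * w) / w"
    by (auto simp: eventually_at_filter field_simps)
  ultimately have "((\<lambda>w. (\<psi> w - s0 - deriv \<psi> 0 * w) / w) \<longlongrightarrow> 0) (at 0)"
    by (rule Lim_transform_eventually)
  then have o: "(\<lambda>w. \<psi> w - s0 - deriv \<psi> 0 * w) \<in> o[at 0](\<lambda>w. w)"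
    by (rule smalloI_tendsto) (auto simp: eventually_at_filter)
  have lim: "filterlim q (at 0) (at \<mu>0 within sphere 0 1)"
    unfolding q_def by (rule filterlim_csqrt_shift)
  moreover have "filterlim (\<lambda>w::complex. - w) (at 0) (at 0)"
    by (rule filterlim_atI) (auto intro!: tendsto_eq_intros simp: eventually_at_filter)
  ultimately have lim': "filterlim (\<lambda>\<mu>. - q \<mu>) (at 0) (at \<mu>0 within sphere 0 1)"
    using filterlim_compose by blast
  have o_plus: "(\<lambda>\<mu>. \<psi> (q \<mu>) - s0 - deriv \<psi> 0 * q \<mu>) \<in> o[at \<mu>0 within sphere 0 1](q)"
    using landau_o.small.compose [OF o lim] by simp
  have o_minus: "(\<lambda>\<mu>. \<psi> (- q \<mu>) - s0 + deriv \<psi> 0 * q \<mu>) \<in> o[at \<mu>0 within sphere 0 1](q)"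
    using landau_o.small.compose [OF o lim'] by simp
  show ?thesis
    unfolding sqrt_normal_form_def
  proof (intro exI conjI allI impI)
    show "\<rho> > 0" "e > 0"
      by fact+
    show "{s. norm (s - s0) < \<rho> \<and> p \<mu> s = 0} = {\<psi> (q \<mu>), \<psi> (- q \<mu>)}"
      if "norm \<mu> = 1 \<and> norm (\<mu> - \<mu>0) < e" for \<mu>
      using set_eq that by blast
  qed (use o_plus o_minus in \<open>simp_all add: q_def\<close>)
qed

section \<open>Bifurcation at a critical multiplier\<close>

context reflection_symmetric_entire
begin

lemma reflection_symmetric_deriv: "reflection_symmetric_entire (deriv f)"
  by unfold_locales (auto intro: holomorphic_deriv hol simp: deriv_reflection)

lemma deriv_axis_reflection:
  assumes "Re s = 0"
  shows "deriv f (-s) = cnj (deriv f s)" "deriv (deriv f) (-s) = cnj (deriv (deriv f) s)"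
  using reflection_symmetric_entire.axis_reflection [OF reflection_symmetric_deriv assms]
    reflection_symmetric_entire.axis_reflection
      [OF reflection_symmetric_entire.reflection_symmetric_deriv [OF reflection_symmetric_deriv] assms]
  by simp_all

lemma critical_multiplier_iff:
  "critical_multiplier (floquet_cubic f) \<mu> s \<longleftrightarrow>
     norm \<mu> = 1 \<and> floquet_cubic f \<mu> s = 0 \<and> deriv f (-s) + deriv f s * \<mu> = 0"
proof -
  have "deriv (\<lambda>s. floquet_cubic f \<mu> s) s = \<mu> * (deriv f (-s) + deriv f s * \<mu>)"
    using DERIV_imp_deriv [OF DERIV_cubic] by (simp add: algebra_simps power2_eq_square)
  moreover have "norm \<mu> = 1 \<Longrightarrow> \<mu> \<noteq> 0"
    by auto
  ultimately show ?thesis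
    unfolding critical_multiplier_def by auto
qed

lemma critical_multiplier_exists:
  assumes "Re s = 0" "Phi3 f s = 0" "deriv f s \<noteq> 0"
  shows "\<exists>\<mu>. critical_multiplier (floquet_cubic f) \<mu> s"
proof
  define \<mu> where "\<mu> = - deriv f (-s) / deriv f s"
  have "norm \<mu> = 1"
    using assms by (simp add: \<mu>_def deriv_axis_reflection norm_divide)
  moreover have "deriv f (-s) + deriv f s * \<mu> = 0"
    using assms by (simp add: \<mu>_def)
  moreover from this have "floquet_cubic f \<mu> s = 0"
    using assms Phi3_eq_cubic by simp
  ultimately show "critical_multiplier (floquet_cubic f) \<mu> s"
    by (simp add: critical_multiplier_iff)
qed

lemma discriminant_imp_simple:
  assumes "Re s = 0" "Delta3 f s \<noteq> 0" "floquet_cubic f \<mu> s = 0"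
  shows "cubic_slope f \<mu> \<mu> s \<noteq> 0"
proof
  assume "cubic_slope f \<mu> \<mu> s = 0"
  then have "(f s)\<^sup>2 * (f (-s))\<^sup>2 - 4 * f s ^ 3 - 4 * f (-s) ^ 3 + 18 * f s * f (-s) - 27 = 0"
    using assms(3) by (intro cubic_double_root_discriminant [of _ \<mu>])
      (auto simp: floquet_cubic_def cubic_slope_def power2_eq_square algebra_simps)
  moreover have "of_real ((norm (f s))\<^sup>2) = f s * f (-s)"
    using axis_reflection [OF assms(1)] by (simp only: complex_norm_square)
  moreover from this have "of_real (norm (f s) ^ 4) = (f s)\<^sup>2 * (f (-s))\<^sup>2"
    by (metis mult_2_right numeral_Bit0 of_real_power power_add power_mult_distrib power2_eq_square)
  ultimately have "Delta3 f s = 0"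
    unfolding Delta3_def axis_reflection [OF assms(1), symmetric] by (simp add: mult.assoc)
  with assms(2) show False ..
qed

text \<open>Conjugation multiplies both the second derivative \<open>P\<close> of the cubic in \<open>s\<close> and \<open>\<i> \<mu>\<close> times its derivative in
  \<open>\<mu>\<close> by the same factor \<open>- \<mu>\<^sup>-\<^sup>3\<close>; for the latter this uses that \<open>\<mu>\<close> is a root. Hence their
  quotient is invariant under conjugation.\<close>
lemma critical_direction_real:
  assumes "Re s = 0" "norm \<mu> = 1" "floquet_cubic f \<mu> s = 0"
    and P: "P = deriv (deriv f) s * \<mu>\<^sup>2 - deriv (deriv f) (-s) * \<mu>"
  shows "\<i> * \<mu> * cubic_slope f \<mu> \<mu> s / P \<in> \<real>"
proof -
  define v where "v = cnj \<mu>"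
  have v: "\<mu> * v = 1"
    using assms(2) by (simp add: v_def complex_norm_square [symmetric])
  define Y where "Y = \<i> * \<mu> * cubic_slope f \<mu> \<mu> s"
  have p: "1 - cnj (f s) * \<mu> + f s * \<mu>\<^sup>2 - \<mu>^3 = 0"
    using assms(3) by (simp add: floquet_cubic_def axis_reflection [OF assms(1)])
  have cP: "cnj P = - (v^3) * P"
  proof -
    define b where "b = deriv (deriv f) s"
    have "cnj P = cnj b * v\<^sup>2 - b * v"
      unfolding P b_def by (simp add: deriv_axis_reflection [OF assms(1)] v_def)
    moreover have "P = b * \<mu>\<^sup>2 - cnj b * \<mu>"
      unfolding P b_def by (simp add: deriv_axis_reflection [OF assms(1)])
    ultimately show ?thesis
      using v by algebra
  qed
  have cY: "cnj Y = - (v^3) * Y"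
  proof -
    define a where "a = f s"
    define a' where "a' = cnj a"
    have "Y = \<i> * (\<mu> * (- a' + a * (\<mu> + \<mu>) - (\<mu>\<^sup>2 + \<mu> * \<mu> + \<mu>\<^sup>2)))"
      by (simp add: Y_def cubic_slope_def axis_reflection [OF assms(1)] a_def a'_def)
    moreover have "cnj Y = - \<i> * (v * (- a + a' * (v + v) - (v\<^sup>2 + v * v + v\<^sup>2)))"
      by (simp add: Y_def cubic_slope_def axis_reflection [OF assms(1)] a_def a'_def v_def)
    moreover have "v * (- a + a' * (v + v) - (v\<^sup>2 + v * v + v\<^sup>2))
        = v^3 * (\<mu> * (- a' + a * (\<mu> + \<mu>) - (\<mu>\<^sup>2 + \<mu> * \<mu> + \<mu>\<^sup>2)))"
      using v p unfolding a_def [symmetric] a'_def [symmetric] by algebra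
    ultimately show ?thesis
      by simp
  qed
  have "v \<noteq> 0"
    using v by auto
  then have "cnj (Y / P) = Y / P"
    by (simp add: cP cY)
  then show ?thesis
    by (simp add: Y_def Reals_cnj_iff)
qed

lemma imaginary_axis_in_spectrum:
  "imaginary_axis \<subseteq> {s. \<exists>\<mu>. norm \<mu> = 1 \<and> floquet_cubic f \<mu> s = 0}"
proof
  fix s assume "s \<in> imaginary_axis"
  then have "f (-s) = cnj (f s)"
    by (simp add: imaginary_axis_def axis_reflection)
  then show "s \<in> {s. \<exists>\<mu>. norm \<mu> = 1 \<and> floquet_cubic f \<mu> s = 0}"
    using self_inversive_cubic_unimodular_root [of "f s"] by (auto simp: floquet_cubic_def)
qed

text \<open>The branch \<open>m\<close> of the multiplier satisfies \<open>m'(s0) = 0\<close> and \<open>m''(s0) = - P / D\<close>, where \<open>D\<close> and \<open>P\<close>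
  are the derivative of the cubic in \<open>\<mu>\<close> and its second derivative in \<open>s\<close>. Both are nonzero by the
  two nondegeneracy conditions.\<close>
lemma critical_multiplier_bifurcation:
  assumes s0: "Re s0 = 0" and crit: "critical_multiplier (floquet_cubic f) \<mu>0 s0"
    and disc: "Delta3 f s0 \<noteq> 0"
    and nondeg: "deriv f (-s0) * deriv (deriv f) s0 \<noteq> - (deriv f s0 * deriv (deriv f) (-s0))"
  shows "bifurcates_off_axis {s. \<exists>\<mu>. norm \<mu> = 1 \<and> floquet_cubic f \<mu> s = 0} s0"
    and "\<exists>\<alpha>. \<alpha> \<noteq> 0 \<and> sqrt_normal_form (floquet_cubic f) \<mu>0 s0 \<alpha>"
proof -
  have \<mu>0: "norm \<mu>0 = 1" and root: "floquet_cubic f \<mu>0 s0 = 0" and a: "deriv f (-s0) + deriv f s0 * \<mu>0 = 0"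
    using crit by (auto simp: critical_multiplier_iff)
  then have "\<mu>0 \<noteq> 0"
    by auto
  define D where "D = cubic_slope f \<mu>0 \<mu>0 s0"
  have "D \<noteq> 0"
    unfolding D_def by (rule discriminant_imp_simple [OF s0 disc root])
  define P where "P = deriv (deriv f) s0 * \<mu>0\<^sup>2 - deriv (deriv f) (-s0) * \<mu>0"
  have "P \<noteq> 0"
  proof
    assume "P = 0"
    then have "deriv (deriv f) s0 * \<mu>0 = deriv (deriv f) (-s0)"
      using \<open>\<mu>0 \<noteq> 0\<close> by (simp add: P_def power2_eq_square)
    moreover have "deriv f (-s0) = - (deriv f s0 * \<mu>0)"
      using a by (simp add: eq_neg_iff_add_eq_0)
    ultimately show False
      using nondeg by (metis mult.assoc mult.commute mult_minus_left)
  qed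
  obtain m r d where "r > 0" "d > 0" and m0: "m s0 = \<mu>0"
    and uniq: "\<And>s \<mu>. \<lbrakk>s \<in> ball s0 r; \<mu> \<in> ball \<mu>0 d\<rbrakk> \<Longrightarrow> floquet_cubic f \<mu> s = 0 \<longleftrightarrow> \<mu> = m s"
    and mroot: "\<And>s. s \<in> ball s0 r \<Longrightarrow> floquet_cubic f (m s) s = 0"
    and slope: "\<And>s. s \<in> ball s0 r \<Longrightarrow> cubic_slope f (m s) (m s) s \<noteq> 0"
    and dm: "\<And>s. s \<in> ball s0 r \<Longrightarrow> (m has_field_derivative
        - (deriv f (-s) * m s + deriv f s * (m s)\<^sup>2) / cubic_slope f (m s) (m s) s) (at s)"
    by (rule simple_multiplier_branch [OF root \<open>D \<noteq> 0\<close> [unfolded D_def]]) (rule that; assumption)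
  have s0r: "s0 \<in> ball s0 r"
    using \<open>r > 0\<close> by simp
  have hol_m: "m holomorphic_on ball s0 r"
    unfolding holomorphic_on_open [OF open_ball] using dm by blast
  define N where "N = (\<lambda>s. deriv f (-s) * m s + deriv f s * (m s)\<^sup>2)"
  have N0: "N s0 = 0"
  proof -
    have "N s0 = \<mu>0 * (deriv f (-s0) + deriv f s0 * \<mu>0)"
      by (simp add: N_def m0 power2_eq_square algebra_simps)
    then show ?thesis
      by (simp add: a)
  qed
  have deriv_m: "deriv m s = - N s / cubic_slope f (m s) (m s) s" if "s \<in> ball s0 r" for s
    using DERIV_imp_deriv [OF dm [OF that]] by (simp add: N_def)
  then have m1: "deriv m s0 = 0"
    using s0r N0 by simp
  have m': "(m has_field_derivative 0) (at s0)"
    using holomorphic_derivI [OF hol_m open_ball s0r] m1 by simp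
  have m2: "deriv (deriv m) s0 = - P / D"
  proof -
    interpret f': reflection_symmetric_entire "deriv f"
      by (rule reflection_symmetric_deriv)
    have dN: "(N has_field_derivative P) (at s0)"
      unfolding N_def P_def
      by (auto intro!: derivative_eq_intros m' f'.DERIV_f DERIV_compose_uminus [OF f'.DERIV_f] simp: m0)
    have "\<exists>Q'. ((\<lambda>s. cubic_slope f (m s) (m s) s) has_field_derivative Q') (at s0)"
      unfolding cubic_slope_def
      by (rule exI, (rule m' DERIV_f DERIV_compose_uminus [OF DERIV_f] derivative_intros)+)
    then obtain Q' where dQ: "((\<lambda>s. cubic_slope f (m s) (m s) s) has_field_derivative Q') (at s0)" ..
    have "((\<lambda>s. - N s / cubic_slope f (m s) (m s) s) has_field_derivative
        (- P * D - - N s0 * Q') / (D * D)) (at s0)"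
      using DERIV_divide [OF DERIV_minus [OF dN] dQ] slope [OF s0r] by (simp add: D_def m0)
    then have "((\<lambda>s. - N s / cubic_slope f (m s) (m s) s) has_field_derivative - P / D) (at s0)"
      using \<open>D \<noteq> 0\<close> by (simp add: N0)
    then have "(deriv m has_field_derivative - P / D) (at s0)"
      by (rule has_field_derivative_transform_within_open [OF _ open_ball s0r]) (simp add: deriv_m)
    then show ?thesis
      by (rule DERIV_imp_deriv)
  qed
  then have "deriv (deriv m) s0 \<noteq> 0"
    using \<open>P \<noteq> 0\<close> \<open>D \<noteq> 0\<close> by simp
  then obtain \<psi> R \<rho> where "R > 0" "\<rho> > 0" and \<psi>: "\<psi> holomorphic_on ball 0 R" "\<psi> 0 = s0"
    and \<psi>': "deriv (deriv m) s0 * (deriv \<psi> 0)\<^sup>2 = 2"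
    and m\<psi>: "\<And>w. w \<in> ball 0 R \<Longrightarrow> \<psi> w \<in> ball s0 r \<and> m (\<psi> w) = m s0 + w\<^sup>2"
    and cover: "ball s0 \<rho> \<subseteq> \<psi> ` ball 0 R"
    by (rule double_point_square_root_coordinate [OF hol_m \<open>r > 0\<close> m1]) (rule that; assumption)
  define \<beta> where "\<beta> = deriv \<psi> 0"
  have \<beta>2: "\<beta>\<^sup>2 = - (2 * D / P)"
  proof -
    have "- P * \<beta>\<^sup>2 = 2 * D"
      using \<psi>' \<open>D \<noteq> 0\<close> unfolding m2 \<beta>_def [symmetric] by (simp add: field_simps)
    then have "P * \<beta>\<^sup>2 = - (2 * D)"
      by (simp add: minus_equation_iff)
    then show ?thesis
      using \<open>P \<noteq> 0\<close> by (simp add: field_simps)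
  qed
  have "\<beta> \<noteq> 0"
    using \<beta>2 \<open>P \<noteq> 0\<close> \<open>D \<noteq> 0\<close> by auto
  have "sqrt_normal_form (floquet_cubic f) \<mu>0 s0 \<beta>"
    unfolding \<beta>_def
    by (rule sqrt_normal_form_of_coordinate [OF \<psi>(1) \<open>R > 0\<close> \<psi>(2) \<open>\<rho> > 0\<close> \<open>d > 0\<close> cover])
       (use uniq m\<psi> in \<open>auto simp: m0\<close>)
  with \<open>\<beta> \<noteq> 0\<close> show "\<exists>\<alpha>. \<alpha> \<noteq> 0 \<and> sqrt_normal_form (floquet_cubic f) \<mu>0 s0 \<alpha>"
    by blast
  have "\<i> * \<mu>0 * D / P \<in> \<real>"
    unfolding D_def by (rule critical_direction_real [OF s0 \<mu>0 root P_def])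
  then obtain \<kappa> where \<kappa>: "\<i> * \<mu>0 * D / P = of_real \<kappa>"
    by (auto elim: Reals_cases)
  have "\<kappa> \<noteq> 0"
    using \<kappa> \<open>\<mu>0 \<noteq> 0\<close> \<open>D \<noteq> 0\<close> \<open>P \<noteq> 0\<close> by auto
  \<comment> \<open>the direction along the circle for which \<open>(\<beta> c)\<^sup>2 = - 4 \<epsilon> \<kappa>\<close> is positive, so that the
    curve leaves \<open>s0\<close> in a real direction\<close>
  define \<epsilon> where "\<epsilon> = - sgn \<kappa>"
  define c where "c = csqrt (2 * \<i> * of_real \<epsilon> * \<mu>0)"
  have c: "c\<^sup>2 = 2 * \<i> * of_real \<epsilon> * \<mu>0"
    by (simp add: c_def)
  have "(\<beta> * c)\<^sup>2 = - 4 * of_real \<epsilon> * (\<i> * \<mu>0 * D / P)"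
    by (simp add: power_mult_distrib \<beta>2 c)
  also have "\<dots> = of_real (4 * \<bar>\<kappa>\<bar>)"
    unfolding \<kappa> by (simp add: \<epsilon>_def abs_sgn mult.commute)
  finally have "(Re (\<beta> * c))\<^sup>2 - (Im (\<beta> * c))\<^sup>2 = 4 * \<bar>\<kappa>\<bar>"
    by (metis Re_complex_of_real Re_power2)
  then have "Re (\<beta> * c) \<noteq> 0"
    using \<open>\<kappa> \<noteq> 0\<close> by (smt (verit) zero_power2 zero_le_power2)
  moreover have "\<psi> w \<in> {s. \<exists>\<mu>. norm \<mu> = 1 \<and> floquet_cubic f \<mu> s = 0}"
    if "w \<in> ball 0 R" "norm (\<mu>0 + w\<^sup>2) = 1" for w
    using m\<psi> [OF that(1)] mroot that(2) m0 by (metis (mono_tags, lifting) mem_Collect_eq)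
  moreover have "\<psi> 0 \<in> imaginary_axis"
    using s0 by (simp add: \<psi> imaginary_axis_def)
  ultimately have "bifurcates_off_axis {s. \<exists>\<mu>. norm \<mu> = 1 \<and> floquet_cubic f \<mu> s = 0} (\<psi> 0)"
    using square_root_curve_bifurcates [OF \<psi>(1) \<open>R > 0\<close> c \<mu>0 _ _ imaginary_axis_in_spectrum]
    unfolding \<beta>_def by blast
  then show "bifurcates_off_axis {s. \<exists>\<mu>. norm \<mu> = 1 \<and> floquet_cubic f \<mu> s = 0} s0"
    by (simp add: \<psi>)
qed

end

theorem theorem4:
  fixes A V :: "real \<Rightarrow> complex \<Rightarrow> complex^3^3"
    and M :: "complex \<Rightarrow> complex^3^3"
    and f :: "complex \<Rightarrow> complex"
    and T :: real
  assumes T_pos: "T > 0"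
    and periodic: "\<And>x s. A (x + T) s = A x s"
    and cont: "continuous_on UNIV (\<lambda>(x, s). A x s)"
    and entire: "\<And>x i j. (\<lambda>s. A x s $ i $ j) holomorphic_on UNIV"
    and A1: "\<And>x s i j. s \<in> \<real> \<Longrightarrow> A x s $ i $ j \<in> \<real>"
    and A2: "\<exists>B :: complex \<Rightarrow> complex^3^3.
               (\<forall>x s. transpose (A x s) ** B s = - (B s ** A x (-s))) \<and>
               finite {s. \<not> invertible (B s)}"
    and trace_zero: "\<And>x s. trace (A x s) = 0"
    and fundamental: "fundamental_matrix A V"
    and M_def: "M = (\<lambda>s. V T s)"
    and f_def: "f = (\<lambda>s. trace (M s))"
  shows "(\<forall>s0\<in>imaginary_axis.
            bifurcates_off_axis (essential_spectrum M) s0 \<longrightarrow> Phi3 f s0 = 0) \<and>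
         (\<forall>s0\<in>imaginary_axis.
            Phi3 f s0 = 0 \<and> Delta3 f s0 \<noteq> 0 \<and>
            deriv f (-s0) * deriv (deriv f) s0 \<noteq> - (deriv f s0 * deriv (deriv f) (-s0)) \<longrightarrow>
            bifurcates_off_axis (essential_spectrum M) s0 \<and>
            (\<exists>\<mu>0. critical_multiplier (floquet_poly M) \<mu>0 s0) \<and>
            (\<forall>\<mu>0. critical_multiplier (floquet_poly M) \<mu>0 s0 \<longrightarrow>
               (\<exists>\<alpha>. \<alpha> \<noteq> 0 \<and> sqrt_normal_form (floquet_poly M) \<mu>0 s0 \<alpha>)))"
proof -
  have hol: "f holomorphic_on UNIV"
    unfolding f_def M_def
    by (intro holomorphic_trace fundamental_matrix_holomorphic [OF fundamental cont T_pos entire])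
  have "f s \<in> \<real>" if "s \<in> \<real>" for s
    unfolding f_def M_def trace_def
    by (intro sum_in_Reals fundamental_matrix_Reals [OF fundamental cont T_pos A1 [OF that]])
  then interpret reflection_symmetric_entire f
    using hol reflection_of_real_entire [OF hol] by unfold_locales auto
  have M: "M = V T"
    by (simp add: M_def)
  have poly: "floquet_poly M = floquet_cubic f"
    using monodromy_floquet_poly [OF T_pos cont entire A2 trace_zero fundamental]
    by (intro ext) (simp add: M f_def floquet_cubic_def)
  have spectrum: "essential_spectrum M = {s. \<exists>\<mu>. norm \<mu> = 1 \<and> floquet_cubic f \<mu> s = 0}"
    by (simp add: essential_spectrum_def poly)
  show ?thesis
  proof (intro conjI ballI impI)
    fix s0 assume "s0 \<in> imaginary_axis" "bifurcates_off_axis (essential_spectrum M) s0"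
    then show "Phi3 f s0 = 0"
      by (intro bifurcation_imp_Phi3_eq_0) (simp_all add: imaginary_axis_def spectrum)
  next
    fix s0 assume "s0 \<in> imaginary_axis"
      and *: "Phi3 f s0 = 0 \<and> Delta3 f s0 \<noteq> 0 \<and>
        deriv f (-s0) * deriv (deriv f) s0 \<noteq> - (deriv f s0 * deriv (deriv f) (-s0))"
    then have s0: "Re s0 = 0"
      by (simp add: imaginary_axis_def)
    have "deriv f s0 \<noteq> 0"
      using * deriv_axis_reflection(1) [OF s0] by auto
    then show ex: "\<exists>\<mu>0. critical_multiplier (floquet_poly M) \<mu>0 s0"
      unfolding poly using * s0 by (intro critical_multiplier_exists) auto
    show "bifurcates_off_axis (essential_spectrum M) s0"
      using ex * critical_multiplier_bifurcation(1) [OF s0] unfolding poly spectrum by blast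
    show "\<forall>\<mu>0. critical_multiplier (floquet_poly M) \<mu>0 s0 \<longrightarrow>
        (\<exists>\<alpha>. \<alpha> \<noteq> 0 \<and> sqrt_normal_form (floquet_poly M) \<mu>0 s0 \<alpha>)"
      using * critical_multiplier_bifurcation(2) [OF s0] unfolding poly by blast
  qed
qed

end
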